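(* Let $\alpha\approx 0.278$ be the real solution of the equation $\alpha e^{1+\alpha}=1$, and for an integer $d\ge 2$ let $\eta_d=\frac{\alpha^{d-1}(d-1)^{d-1}}{d^d}$. For every integer $d\ge 2$ and every real $0\le\eta<\eta_d$ there exists a constant $\gamma=\gamma(d,\eta)>0$ such that for every positive integer $n$ and every real $0<\epsilon<1$ there is a polynomial $p=p_{d,\eta,\epsilon,n}$ in the entries of a $d$-dimensional $n\times\cdots\times n$ tensor such that $\deg p\le\gamma(\ln n-\ln\epsilon)$ and $$\left|\ln\operatorname{PER}A-p(A)\right|\le\epsilon$$ for every $d$-dimensional $n\times\cdots\times n$ complex tensor $A=(a_{i_1\ldots i_d})$ for which the sum of $|1-a_{i_1\ldots i_d}|$ over each slice of $A$ does not exceed $\eta n^{d-1}$.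
   Context: The permanent of a $d$-dimensional $n\times\cdots\times n$ array (tensor) $A=(a_{i_1\ldots i_d})$ of $n^d$ real or complex numbers is $$\operatorname{PER}A=\sum_{\sigma_2,\dots,\sigma_d\in S_n}\ \prod_{i=1}^n a_{i\,\sigma_2(i)\ldots\sigma_d(i)},$$ where $S_n$ is the symmetric group of permutations of $\{1,\dots,n\}$. A slice of $A$ is the array of $n^{d-1}$ entries of $A$ obtained by fixing one of the indices $i_1,\dots,i_d$ to a particular value and letting the remaining $d-1$ indices vary arbitrarily over $\{1,\dots,n\}$; thus $A$ has $nd$ slices. Branch of the logarithm: let $D$ be the convex set of all $d$-dimensional $n\times\cdots\times n$ complex tensors $Z$ for which the sum of $|1-z_{i_1\ldots i_d}|$ over each slice does not exceed $\eta_d n^{d-1}$. $\operatorname{PER}$ has no zeros on $D$, and $\ln\operatorname{PER}$ denotes the continuous branch on $D$ (a continuous function $L$ with $e^{L(Z)}=\operatorname{PER}Z$) which is real at real tensors; in particular its value at the all-ones tensor is the real number $(d-1)\ln n!$. *)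

theory Defs
  imports "HOL-Analysis.Analysis" "HOL-Library.Poly_Mapping"
begin

definition tensor_indices :: "nat \<Rightarrow> nat \<Rightarrow> nat list set" where
  "tensor_indices d n = {xs. length xs = d \<and> set xs \<subseteq> {1..n}}"

text \<open>
  Tensors are functions on index lists that vanish outside the index set. On this set the
  product topology of the function type is the Euclidean topology on the $n^d$ entries.
\<close>

definition tensors :: "nat \<Rightarrow> nat \<Rightarrow> (nat list \<Rightarrow> complex) set" where
  "tensors d n = {A. \<forall>xs. xs \<notin> tensor_indices d n \<longrightarrow> A xs = 0}"

text \<open>
  The list \<open>\<pi>s\<close> holds the permutations $\sigma_2, \dots, \sigma_d$.
\<close>

definition PER :: "nat \<Rightarrow> nat \<Rightarrow> (nat list \<Rightarrow> complex) \<Rightarrow> complex" where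
  "PER d n A =
     (\<Sum>\<pi>s \<in> {\<pi>s. length \<pi>s = d - 1 \<and> set \<pi>s \<subseteq> {\<pi>. \<pi> permutes {1..n}}}.
        \<Prod>i\<in>{1..n}. A (i # map (\<lambda>\<pi>. \<pi> i) \<pi>s))"

text \<open>List positions are counted from 0, so the slices are given by \<open>k < d\<close> and \<open>j \<in> {1..n}\<close>.\<close>

definition slice_indices :: "nat \<Rightarrow> nat \<Rightarrow> nat \<Rightarrow> nat \<Rightarrow> nat list set" where
  "slice_indices d n k j = {xs \<in> tensor_indices d n. xs ! k = j}"

definition near_ones :: "nat \<Rightarrow> nat \<Rightarrow> real \<Rightarrow> (nat list \<Rightarrow> complex) set" where
  "near_ones d n r =
     {A \<in> tensors d n. \<forall>k<d. \<forall>j\<in>{1..n}.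
        (\<Sum>xs\<in>slice_indices d n k j. cmod (1 - A xs)) \<le> r * real n ^ (d - 1)}"

definition alpha :: real where
  "alpha = (THE x. x * exp (1 + x) = 1)"

lemma alpha_unique: "\<exists>!x::real. x * exp (1 + x) = 1"
proof -
  have "\<exists>x\<ge>0. x \<le> 1 \<and> x * exp (1 + x) = (1::real)"
  proof (rule IVT)
    show "\<forall>x. 0 \<le> x \<and> x \<le> 1 \<longrightarrow> isCont (\<lambda>x. x * exp (1 + x) :: real) x"
      by (auto intro!: continuous_intros)
  qed auto
  then obtain x :: real where x: "x * exp (1 + x) = 1" by blast
  have pos: "y > 0" if "y * exp (1 + y) = 1" for y :: real
    using that by (metis exp_gt_zero zero_less_mult_pos2 zero_less_one)
  have False if "y < z" "y * exp (1 + y) = 1" "z * exp (1 + z) = 1" for y z :: real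
  proof -
    have "y * exp (1 + y) < z * exp (1 + z)"
      using that pos[OF that(2)] by (intro mult_strict_mono) auto
    with that show False by simp
  qed
  with x show ?thesis by (metis linorder_neqE_linordered_idom)
qed

definition eta_max :: "nat \<Rightarrow> real" where
  "eta_max d = alpha ^ (d - 1) * real (d - 1) ^ (d - 1) / real d ^ d"

definition lnPER_branch :: "nat \<Rightarrow> nat \<Rightarrow> ((nat list \<Rightarrow> complex) \<Rightarrow> complex) \<Rightarrow> bool" where
  "lnPER_branch d n L \<longleftrightarrow>
     continuous_on (near_ones d n (eta_max d)) L \<and>
     (\<forall>Z \<in> near_ones d n (eta_max d). exp (L Z) = PER d n Z) \<and>
     (\<forall>Z \<in> near_ones d n (eta_max d). (\<forall>xs. Z xs \<in> \<real>) \<longrightarrow> L Z \<in> \<real>)"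

text \<open>
  Two branches agree on \<open>near_ones d n (eta_max d)\<close>, so the choice below does not
  affect the values there; see \<open>lnPER_branch_unique\<close>.
\<close>

definition lnPER :: "nat \<Rightarrow> nat \<Rightarrow> (nat list \<Rightarrow> complex) \<Rightarrow> complex" where
  "lnPER d n = (SOME L. lnPER_branch d n L)"

lemma lnPER_branch_unique:
  assumes L: "lnPER_branch d n L" and M: "lnPER_branch d n M"
    and Z: "Z \<in> near_ones d n (eta_max d)"
  shows "L Z = M Z"
proof -
  let ?D = "near_ones d n (eta_max d)"
  define g :: "real \<Rightarrow> nat list \<Rightarrow> complex"
    where "g t xs = (if xs \<in> tensor_indices d n then 1 + of_real t * (Z xs - 1) else 0)" for t xs
  have gD: "g t \<in> ?D" if t: "t \<in> {0..1}" for t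
  proof -
    have "(\<Sum>xs\<in>slice_indices d n k j. cmod (1 - g t xs)) \<le> eta_max d * real n ^ (d - 1)"
      if kj: "k < d" "j \<in> {1..n}" for k j
    proof -
      have "cmod (1 - g t xs) \<le> cmod (1 - Z xs)" if "xs \<in> slice_indices d n k j" for xs
      proof -
        have "cmod (1 - g t xs) = t * cmod (1 - Z xs)"
          using that t by (simp add: g_def slice_indices_def norm_mult norm_minus_commute)
        also have "\<dots> \<le> 1 * cmod (1 - Z xs)"
          using t by (intro mult_right_mono) auto
        finally show ?thesis by simp
      qed
      hence "(\<Sum>xs\<in>slice_indices d n k j. cmod (1 - g t xs))
          \<le> (\<Sum>xs\<in>slice_indices d n k j. cmod (1 - Z xs))"
        by (rule sum_mono)
      also have "\<dots> \<le> eta_max d * real n ^ (d - 1)"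
        using Z kj by (simp add: near_ones_def)
      finally show ?thesis .
    qed
    thus ?thesis by (simp add: near_ones_def tensors_def g_def)
  qed
  have g1: "g 1 = Z"
    using Z by (auto simp: g_def near_ones_def tensors_def fun_eq_iff)
  have contg: "continuous_on {0..1} g"
  proof (rule continuous_on_coordinatewise_then_product)
    fix xs
    show "continuous_on {0..1} (\<lambda>t. g t xs)"
      by (cases "xs \<in> tensor_indices d n") (auto simp: g_def intro!: continuous_intros)
  qed
  define h where "h t = L (g t) - M (g t)" for t
  have sub: "g ` {0..1} \<subseteq> ?D" using gD by blast
  have contL: "continuous_on ?D L" and contM: "continuous_on ?D M"
    using L M by (simp_all add: lnPER_branch_def)
  have conth: "continuous_on {0..1} h"
    unfolding h_def
    by (intro continuous_on_diff continuous_on_compose2[OF contL contg sub]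
        continuous_on_compose2[OF contM contg sub])
  have period: "\<exists>k::int. h t = of_int (2 * k) * of_real pi * \<i>" if t: "t \<in> {0..1}" for t
  proof -
    have "exp (L (g t)) = exp (M (g t))"
      using L M gD[OF t] by (simp add: lnPER_branch_def)
    then obtain k :: int where "L (g t) = M (g t) + (of_int (2 * k) * of_real pi) * \<i>"
      unfolding exp_eq by auto
    hence "h t = of_int (2 * k) * of_real pi * \<i>"
      unfolding h_def by (metis add_diff_cancel_left')
    thus ?thesis by blast
  qed
  have "h constant_on {0..1}"
  proof (rule continuous_discrete_range_constant[OF _ conth])
    show "connected {0..1::real}" by simp
    fix s :: real assume s: "s \<in> {0..1}"
    have "2 * pi \<le> norm (h t - h s)" if t: "t \<in> {0..1}" and ne: "h t \<noteq> h s" for t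
    proof -
      obtain a b :: int where ab: "h s = of_int (2 * a) * of_real pi * \<i>"
        "h t = of_int (2 * b) * of_real pi * \<i>" using period s t by meson
      have "h t - h s = of_real (of_int (2 * (b - a)) * pi) * \<i>"
        using ab by (simp add: algebra_simps)
      hence eq: "norm (h t - h s) = 2 * \<bar>real_of_int (b - a)\<bar> * pi"
        by (simp only: norm_mult norm_of_real norm_ii abs_mult of_int_mult) simp
      have "b \<noteq> a" using ab ne by auto
      hence "1 \<le> \<bar>real_of_int (b - a)\<bar>" by linarith
      thus ?thesis unfolding eq by simp
    qed
    thus "\<exists>e>0. \<forall>t. t \<in> {0..1} \<and> h t \<noteq> h s \<longrightarrow> e \<le> norm (h t - h s)"
      by (intro exI[of _ "2 * pi"]) auto
  qed
  hence h01: "h 1 = h 0" by (auto simp: constant_on_def)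
  have "\<forall>xs. g 0 xs \<in> \<real>" by (simp add: g_def)
  hence "h 0 \<in> \<real>" using L M gD[of 0] by (auto simp: h_def lnPER_branch_def intro: Reals_diff)
  moreover obtain k :: int where k: "h 0 = of_int (2 * k) * of_real pi * \<i>"
    using period[of 0] by auto
  ultimately have "h 0 = 0" by (auto simp: complex_is_Real_iff)
  thus ?thesis using h01 g1 by (simp add: h_def)
qed

text \<open>
  A polynomial with complex coefficients in variables of type \<open>'v\<close> is a finitely supported
  map from monomials to coefficients, a monomial being a finitely supported map from
  variables to exponents. The zero polynomial gets total degree 0.
\<close>

type_synonym 'v cpoly = "('v \<Rightarrow>\<^sub>0 nat) \<Rightarrow>\<^sub>0 complex"

definition poly_vars :: "'v cpoly \<Rightarrow> 'v set" where
  "poly_vars p = (\<Union>m\<in>Poly_Mapping.keys p. Poly_Mapping.keys m)"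

definition total_degree :: "'v cpoly \<Rightarrow> nat" where
  "total_degree p = Max (insert 0
     ((\<lambda>m. \<Sum>v\<in>Poly_Mapping.keys m. Poly_Mapping.lookup m v) ` Poly_Mapping.keys p))"

definition poly_eval :: "'v cpoly \<Rightarrow> ('v \<Rightarrow> complex) \<Rightarrow> complex" where
  "poly_eval p x = (\<Sum>m\<in>Poly_Mapping.keys p. Poly_Mapping.lookup p m *
     (\<Prod>v\<in>Poly_Mapping.keys m. x v ^ Poly_Mapping.lookup m v))"

end

theory Submission
  imports Defs "HOL-Computational_Algebra.Fundamental_Theorem_Algebra"
    "HOL-Computational_Algebra.Polynomial_FPS" "HOL-Combinatorics.Permutations"
begin

unbundle no vec_syntax
unbundle fps_syntax

text \<open>
  Write a tensor as $A = J + B$ with $J$ the all-ones tensor. Multiplying out every product in the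
  permanent and collecting the permutations that extend a given partial diagonal gives
  \[ \mathrm{PER}(J + tB) = \sum_M ((n - |M|)!)^{d-1} t^{|M|} \prod_{e \in M} b_e, \]
  where $M$ runs over the matchings of the complete $d$-partite hypergraph on $d$ classes of $n$
  vertices (\<open>PER_expansion\<close>). If the factorials were absent this would be a matching polynomial.
  Such a polynomial has no zeros as long as the weights at each vertex sum in absolute value to at
  most $(d-1)^{d-1}/d^d$: deleting a vertex then increases the modulus of the matching sum at most by
  the factor $d/(d-1)$, and this is shown by induction on the number of vertices
  (\<open>matching_sum_nonzero\<close>).

  The factorials are restored by Szego's theorem: if $\sum_k a_k z^k$ has no zeros for
  $|z| \le r$ and $\sum_k b_k z^k$ has none for $|z| \le s$, both of degree at most $n$, then
  $\sum_k a_k b_k {n \choose k}^{-1} z^k$ has none for $|z| \le rs$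
  (\<open>Szego_composition\<close>). Taking $b_k = 1/k!$ multiplies $a_k$ by $(n-k)!/n!$, and the truncated
  exponential series $\sum_{k \le n} z^k/k!$ has no zeros for $|z| \le \alpha n$ because
  $\alpha e^{1+\alpha} = 1$ (\<open>truncated_exp_nonzero\<close>). Doing this $d - 1$ times produces exactly the
  constant $\eta_d$, so that $f_A(t) = \mathrm{PER}(J + tB)$ has no zeros for
  $|t| \le \eta_d/\eta$ (\<open>diagonal_poly_nonzero\<close>).

  The formula $\ln f_A(0) + \int_0^1 f_A'(t)/f_A(t)\,dt$ therefore defines the branch of the logarithm.
  The polynomial $f_A$ has at most $n$ zeros, all of modulus greater than $R = \eta_d/\eta > 1$, and the
  partial fractions of $f_A'/f_A$ show that cutting off its Taylor series after $m$ terms costs at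
  most $n R^{-m}/(R-1)$ on the unit disc (\<open>log_deriv_taylor_bound\<close>). The $k$-th Taylor
  coefficient of $f_A'/f_A$ is a polynomial of degree at most $k+1$ in the entries of $A$, since the
  $i$-th coefficient of $f_A$ has degree at most $i$ and the constant coefficient does not depend on $A$. Hence $m$ of order
  $\ln n - \ln \epsilon$ suffices.
\<close>

section \<open>Composition of polynomials without zeros in a disc\<close>

text \<open>
  Splits off one zero, normalised so that the linear factor has constant term 1; this is the
  induction step for statements about polynomials without zeros in a disc.
\<close>

lemma nonvanishing_poly_factor:
  fixes f :: "complex poly"
  assumes deg: "degree f > 0" and nz: "\<And>z. cmod z \<le> R \<Longrightarrow> poly f z \<noteq> 0" and R: "R > 0"
  obtains y g where "f = [:1, y:] * g" "degree f = Suc (degree g)" "cmod y * R < 1"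
    "\<And>z. cmod z \<le> R \<Longrightarrow> poly g z \<noteq> 0"
proof -
  obtain b where b: "poly f b = 0"
    using fundamental_theorem_of_algebra[of f] deg by (auto simp: constant_degree)
  have bR: "cmod b > R" using nz[of b] b by force
  hence b0: "b \<noteq> 0" using R by auto
  obtain h where h: "f = [:-b, 1:] * h" using b poly_eq_0_iff_dvd[of f b] by (auto simp: dvd_def)
  have "f = [:1, - 1 / b:] * smult (- b) h"
  proof -
    have "[:- b, 1:] = smult (- b) [:1, - 1 / b:]" using b0 by simp
    thus ?thesis unfolding h by (simp only: mult_smult_left mult_smult_right)
  qed
  moreover have "degree f = Suc (degree (smult (- b) h))"
  proof -
    have "h \<noteq> 0" using h deg by auto
    hence "degree f = degree [:- b, 1:] + degree h" unfolding h by (intro degree_mult_eq) auto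
    thus ?thesis using b0 by simp
  qed
  moreover have "cmod (- 1 / b) * R < 1" using bR R b0 by (simp add: norm_divide divide_less_eq)
  moreover have "poly (smult (- b) h) z \<noteq> 0" if "cmod z \<le> R" for z
    using nz[OF that] b0 unfolding h by auto
  ultimately show ?thesis using that by blast
qed

text \<open>
  With $w$ the quotient, twice the real part equals
  $(1 - |z|^2)|w|^2 + (1 - |x|^2) + |zw - x|^2 - |w - 1|^2$, and
  $w - 1$ is $-y$ times $zw - x$. Geometrically, $y \mapsto w$ maps the unit disc into a half plane that
  depends on $x$ and $z$ only, so a sum of such quotients cannot vanish.
\<close>

lemma moebius_half_plane:
  assumes x: "cmod x < 1" and y: "cmod y < 1" and z: "cmod z \<le> 1"
  shows "Re ((1 + x * y) / (1 + y * z) * (1 - z * cnj x)) > 0"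
proof -
  have yz: "1 + y * z \<noteq> 0"
  proof
    assume "1 + y * z = 0"
    hence "y * z = -1" by (simp add: eq_neg_iff_add_eq_0 add.commute)
    hence "cmod y * cmod z = 1" by (metis norm_minus_cancel norm_mult norm_one)
    moreover have "cmod y * cmod z \<le> cmod y" using z by (simp add: mult_left_le)
    ultimately show False using y by linarith
  qed
  define w where "w = (1 + x * y) / (1 + y * z)"
  have e1: "w - 1 = y * (x - z) / (1 + y * z)"
    unfolding w_def using yz by (simp add: field_simps)
  have e2: "z * w - x = (z - x) / (1 + y * z)"
    unfolding w_def using yz by (simp add: field_simps)
  have "cmod (w - 1) \<le> cmod (z * w - x)"
    unfolding e1 e2 norm_divide norm_mult using y
    by (intro divide_right_mono) (simp_all add: norm_minus_commute mult_left_le_one_le)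
  hence "(cmod (w - 1))\<^sup>2 \<le> (cmod (z * w - x))\<^sup>2" by (simp add: power_mono)
  moreover have "2 * Re (w * (1 - z * cnj x)) =
      (1 - (cmod z)\<^sup>2) * (cmod w)\<^sup>2 + (1 - (cmod x)\<^sup>2) + ((cmod (z * w - x))\<^sup>2 - (cmod (w - 1))\<^sup>2)"
    unfolding cmod_power2 by (simp add: algebra_simps power2_eq_square)
  moreover have "(1 - (cmod z)\<^sup>2) * (cmod w)\<^sup>2 \<ge> 0" using z by (simp add: power_le_one)
  moreover have "1 - (cmod x)\<^sup>2 > 0" using x by (simp add: power_less_one_iff abs_square_less_1)
  ultimately show ?thesis unfolding w_def[symmetric] by linarith
qed

text \<open>
  Each of the $n$ zeros of $p$, those at infinity included, contributes one quotient as in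
  \<open>moebius_half_plane\<close>, and all of these lie in the same open half plane.
\<close>

lemma Laguerre_half_plane:
  fixes p :: "complex poly"
  assumes "degree p \<le> n" "\<And>z. cmod z \<le> 1 \<Longrightarrow> poly p z \<noteq> 0" "cmod x < 1" "cmod z \<le> 1" "n > 0"
  shows "Re ((of_nat n + (x - z) * poly (pderiv p) z / poly p z) * (1 - z * cnj x)) > 0"
proof -
  have re: "Re (1 - z * cnj x) > 0" using moebius_half_plane[of x 0 z] assms by simp
  have "Re ((of_nat n + (x - z) * poly (pderiv p) z / poly p z) * (1 - z * cnj x)) \<ge> 0 \<and>
    (n > 0 \<longrightarrow> Re ((of_nat n + (x - z) * poly (pderiv p) z / poly p z) * (1 - z * cnj x)) > 0)"
    using assms(1,2)
  proof (induction n arbitrary: p)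
    case 0
    hence "pderiv p = 0" by (simp add: pderiv_eq_0_iff)
    thus ?case by simp
  next
    case (Suc n)
    show ?case
    proof (cases "degree p = 0")
      case True
      hence "pderiv p = 0" by (simp add: pderiv_eq_0_iff)
      thus ?thesis using re mult_pos_pos[of "1 + real n" "Re (1 - z * cnj x)"]
        by (simp add: algebra_simps)
    next
      case False
      then obtain y g where g: "p = [:1, y:] * g" "degree p = Suc (degree g)" "cmod y * 1 < 1"
        "\<And>z. cmod z \<le> 1 \<Longrightarrow> poly g z \<noteq> 0"
        using nonvanishing_poly_factor[of p 1] Suc.prems by auto
      have gz: "poly g z \<noteq> 0" and pz: "poly p z \<noteq> 0" using g(4) Suc.prems(2) assms(4) by auto
      have yz: "1 + y * z \<noteq> 0" using pz unfolding g(1) poly_mult by (simp add: mult.commute)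
      have IH: "Re ((of_nat n + (x - z) * poly (pderiv g) z / poly g z) * (1 - z * cnj x)) \<ge> 0"
        using Suc.IH[of g] g Suc.prems by auto
      have "poly (pderiv p) z / poly p z = y / (1 + y * z) + poly (pderiv g) z / poly g z"
        unfolding g(1) pderiv_mult using gz yz by (simp add: pderiv_pCons field_simps)
      hence "of_nat (Suc n) + (x - z) * poly (pderiv p) z / poly p z
          = (of_nat n + (x - z) * poly (pderiv g) z / poly g z) + (1 + (x - z) * (y / (1 + y * z)))"
        by (simp only: times_divide_eq_right[symmetric]) (simp add: distrib_left)
      also have "1 + (x - z) * (y / (1 + y * z)) = (1 + x * y) / (1 + y * z)"
        using yz by (simp add: field_simps)
      finally have "Re ((of_nat (Suc n) + (x - z) * poly (pderiv p) z / poly p z) * (1 - z * cnj x))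
         = Re ((of_nat n + (x - z) * poly (pderiv g) z / poly g z) * (1 - z * cnj x))
          + Re ((1 + x * y) / (1 + y * z) * (1 - z * cnj x))"
        by (simp only: distrib_right plus_complex.simps)
      thus ?thesis using IH moebius_half_plane[of x y z] g(3) assms by simp
    qed
  qed
  thus ?thesis using assms(5) by simp
qed

text \<open>
  This is Laguerre's theorem for the closed unit disc.
\<close>

lemma polar_derivative_nonvanishing:
  fixes p :: "complex poly"
  assumes "degree p \<le> n" "n > 0" "\<And>z. cmod z \<le> 1 \<Longrightarrow> poly p z \<noteq> 0" "cmod x < 1" "cmod z \<le> 1"
  shows "of_nat n * poly p z + (x - z) * poly (pderiv p) z \<noteq> 0"
proof
  assume "of_nat n * poly p z + (x - z) * poly (pderiv p) z = 0"
  hence "of_nat n + (x - z) * poly (pderiv p) z / poly p z = 0"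
    using assms(3)[OF assms(5)] by (simp add: field_simps)
  thus False using Laguerre_half_plane[OF assms(1,3-5,2)] by simp
qed

text \<open>
  In this normalisation the polar derivative acts on the coefficient sequence by
  $a_k \mapsto a_k + x a_{k+1}$, see \<open>polar_derivative_binomial_poly\<close>.
\<close>

definition binomial_poly :: "nat \<Rightarrow> (nat \<Rightarrow> complex) \<Rightarrow> complex poly" where
  "binomial_poly n a = (\<Sum>k\<le>n. monom (of_nat (n choose k) * a k) k)"

lemma coeff_binomial_poly: "coeff (binomial_poly n a) k = of_nat (n choose k) * a k"
  by (auto simp: binomial_poly_def coeff_sum)

lemma poly_binomial_poly: "poly (binomial_poly n a) z = (\<Sum>k\<le>n. of_nat (n choose k) * a k * z ^ k)"
  by (simp add: binomial_poly_def poly_sum poly_monom)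

lemma degree_binomial_poly: "degree (binomial_poly n a) \<le> n"
  by (rule degree_le) (simp add: coeff_binomial_poly binomial_eq_0)

lemma polar_derivative_binomial_poly:
  "smult (of_nat (Suc n)) (binomial_poly (Suc n) a) + [:x, -1:] * pderiv (binomial_poly (Suc n) a)
     = smult (of_nat (Suc n)) (binomial_poly n (\<lambda>k. a k + x * a (Suc k)))"
proof (rule poly_eqI)
  fix k
  have A: "of_nat (Suc k) * of_nat (Suc n choose Suc k) = (of_nat (Suc n) * of_nat (n choose k) :: complex)"
    by (metis Suc_times_binomial_eq mult.commute of_nat_mult)
  have B: "of_nat (Suc n) * of_nat (Suc n choose k) - of_nat k * of_nat (Suc n choose k)
    = (of_nat (Suc n) * of_nat (n choose k) :: complex)"
  proof (cases k)
    case (Suc j)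
    have "of_nat (Suc j) * of_nat (Suc n choose Suc j) = (of_nat (Suc n) * of_nat (n choose j) :: complex)"
      by (metis Suc_times_binomial_eq mult.commute of_nat_mult)
    thus ?thesis unfolding Suc by (simp add: algebra_simps)
  qed simp
  have "coeff ([:x, -1:] * pderiv (binomial_poly (Suc n) a)) k =
    x * (of_nat (Suc k) * of_nat (Suc n choose Suc k)) * a (Suc k) - of_nat k * of_nat (Suc n choose k) * a k"
    by (cases k) (simp_all add: coeff_pderiv coeff_binomial_poly del: binomial_Suc_Suc of_nat_Suc)
  thus "coeff (smult (of_nat (Suc n)) (binomial_poly (Suc n) a) + [:x, -1:] * pderiv (binomial_poly (Suc n) a)) k =
    coeff (smult (of_nat (Suc n)) (binomial_poly n (\<lambda>k. a k + x * a (Suc k)))) k"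
    unfolding A using B
    by (simp add: coeff_binomial_poly algebra_simps del: binomial_Suc_Suc of_nat_Suc)
qed

text \<open>
  A linear factor $1 + xz$ of $q$ can be moved to the other side: it turns $a$ into
  $a_k + x a_{k+1}$, which is a polar derivative and so preserves the absence of zeros while $n$
  drops by one.
\<close>

lemma Szego_composition:
  fixes q :: "complex poly"
  assumes "degree q \<le> n" "\<And>z. cmod z \<le> 1 \<Longrightarrow> poly q z \<noteq> 0"
    "\<And>z. cmod z \<le> 1 \<Longrightarrow> poly (binomial_poly n a) z \<noteq> 0"
  shows "(\<Sum>k\<le>n. coeff q k * a k) \<noteq> 0"
  using assms
proof (induction n arbitrary: q a)
  case 0
  then obtain c where "q = [:c:]" by (auto elim: degree_eq_zeroE)
  with 0 show ?case using 0(2)[of 0] 0(3)[of 0] by (auto simp: poly_binomial_poly)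
next
  case (Suc n)
  show ?case
  proof (cases "degree q = 0")
    case True
    then obtain c where c: "q = [:c:]" by (auto elim: degree_eq_zeroE)
    have "(\<Sum>k\<le>Suc n. coeff q k * a k) = (\<Sum>k\<in>{0}. coeff q k * a k)"
      unfolding c by (intro sum.mono_neutral_right) (auto simp: coeff_pCons split: nat.split)
    moreover have "a 0 \<noteq> 0" using Suc.prems(3)[of 0]
      by (simp add: poly_0_coeff_0 coeff_binomial_poly)
    moreover have "c \<noteq> 0" using Suc.prems(2)[of 0] c by simp
    ultimately show ?thesis using c by simp
  next
    case False
    then obtain x g where g: "q = [:1, x:] * g" "degree q = Suc (degree g)" "cmod x * 1 < 1"
      "\<And>z. cmod z \<le> 1 \<Longrightarrow> poly g z \<noteq> 0"
      using nonvanishing_poly_factor[of q 1] Suc.prems by auto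
    have dg: "degree g \<le> n" using g Suc.prems by simp
    have co: "coeff q k = coeff g k + (if k = 0 then 0 else x * coeff g (k - 1))" for k
      unfolding g(1) by (cases k) (simp_all)
    have "(\<Sum>k\<le>Suc n. coeff q k * a k) = (\<Sum>k\<le>Suc n. coeff g k * a k)
        + (\<Sum>k\<le>Suc n. (if k = 0 then 0 else x * coeff g (k - 1)) * a k)"
      unfolding co by (simp add: distrib_right sum.distrib)
    also have "(\<Sum>k\<le>Suc n. coeff g k * a k) = (\<Sum>k\<le>n. coeff g k * a k)"
      using dg by (simp add: coeff_eq_0)
    also have "(\<Sum>k\<le>Suc n. (if k = 0 then 0 else x * coeff g (k - 1)) * a k)
        = (\<Sum>k\<le>n. x * coeff g k * a (Suc k))"
      unfolding sum.atMost_Suc_shift by simp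
    finally have eq: "(\<Sum>k\<le>Suc n. coeff q k * a k) = (\<Sum>k\<le>n. coeff g k * (a k + x * a (Suc k)))"
      by (simp add: sum.distrib[symmetric] algebra_simps)
    have "poly (binomial_poly n (\<lambda>k. a k + x * a (Suc k))) z \<noteq> 0" if z: "cmod z \<le> 1" for z
    proof -
      have "of_nat (Suc n) * poly (binomial_poly (Suc n) a) z
          + (x - z) * poly (pderiv (binomial_poly (Suc n) a)) z \<noteq> 0"
        using g(3) Suc.prems(3) z
        by (intro polar_derivative_nonvanishing) (auto simp: degree_binomial_poly)
      moreover have "of_nat (Suc n) * poly (binomial_poly (Suc n) a) z
          + (x - z) * poly (pderiv (binomial_poly (Suc n) a)) z =
          of_nat (Suc n) * poly (binomial_poly n (\<lambda>k. a k + x * a (Suc k))) z"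
        using arg_cong[OF polar_derivative_binomial_poly[of n a x], of "\<lambda>p. poly p z"]
        by (simp add: algebra_simps)
      ultimately show ?thesis by auto
    qed
    thus ?thesis unfolding eq using Suc.IH[of g] dg g(4) by blast
  qed
qed

section \<open>The number $\<alpha>$ and the truncated exponential series\<close>

lemma alpha_eq: "alpha * exp (1 + alpha) = 1"
  using theI'[OF alpha_unique] unfolding alpha_def .

lemma alpha_pos: "alpha > 0"
  using alpha_eq by (metis exp_gt_zero zero_less_mult_pos2 zero_less_one)

lemma alpha_less_half: "alpha < 1 / 2"
proof (rule ccontr)
  assume "\<not> alpha < 1 / 2"
  hence "(1 / 2 :: real) * exp (1 + 1 / 2) \<le> alpha * exp (1 + alpha)"
    by (intro mult_mono) auto
  moreover have "exp (1 + 1 / 2 :: real) > 2"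
    using exp_ge_add_one_self[of "1 + 1 / 2 :: real"] by simp
  ultimately show False using alpha_eq by simp
qed

lemma power_over_fact_le_exp:
  fixes x :: real
  assumes "x \<ge> 0"
  shows "x ^ n / fact n \<le> exp x"
proof -
  have s: "(\<lambda>n. x ^ n / fact n) sums exp x"
    using exp_converges[of x] by (simp add: field_simps)
  have "sum (\<lambda>n. x ^ n / fact n) {n} \<le> suminf (\<lambda>n. x ^ n / fact n)"
    using s assms by (intro sum_le_suminf) (auto simp: sums_iff)
  thus ?thesis using s by (simp add: sums_iff)
qed

text \<open>
  If the partial sum vanished, $e^z$ would equal the tail of its series. For
  $|z| \le x = \alpha n$ the tail is dominated by a geometric series and is at most
  $\frac{x^n}{n!} \cdot \frac{\alpha}{1 - \alpha}$, while $|e^z| \ge e^{-x}$. Since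
  $n^n/n! \le e^n$ and $\alpha = e^{-1-\alpha}$, we have $x^n/n! \le e^{-x}$, and
  $\alpha < 1/2$ makes the tail strictly smaller.
\<close>

lemma truncated_exp_nonzero:
  assumes n: "n \<ge> 1" and z: "cmod z \<le> alpha * real n"
  shows "(\<Sum>k\<le>n. z ^ k / fact k) \<noteq> 0"
proof
  assume zero: "(\<Sum>k\<le>n. z ^ k / fact k) = 0"
  define x where "x = alpha * real n"
  have x: "x \<ge> 0" "cmod z \<le> x" using alpha_pos z by (simp_all add: x_def)
  have "(\<lambda>k. z ^ k / fact k) sums exp z"
    using exp_converges[of z] by (simp add: scaleR_conv_of_real field_simps)
  hence tail: "(\<lambda>i. z ^ (i + Suc n) / fact (i + Suc n)) sums exp z"
    using zero sums_split_initial_segment[of "\<lambda>k. z ^ k / fact k" "exp z" "Suc n"]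
    by (simp only: lessThan_Suc_atMost) simp
  have ratio: "x ^ (n + j) / fact (n + j) \<le> x ^ n / fact n * alpha ^ j" for j
  proof (induction j)
    case (Suc j)
    have "x / real (Suc (n + j)) \<le> alpha"
      using alpha_pos by (simp add: x_def divide_le_eq)
    have "x ^ (n + Suc j) / fact (n + Suc j) = x ^ (n + j) / fact (n + j) * (x / real (Suc (n + j)))"
      by (simp add: field_simps)
    also have "\<dots> \<le> x ^ n / fact n * alpha ^ j * alpha"
      using Suc \<open>x / real (Suc (n + j)) \<le> alpha\<close> x alpha_pos by (intro mult_mono) auto
    finally show ?case by (simp only: power_Suc2 mult.assoc)
  qed simp
  have "(\<lambda>i. alpha ^ i) sums (1 / (1 - alpha))"
    using alpha_pos alpha_less_half by (intro geometric_sums) simp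
  hence geo: "(\<lambda>i. x ^ n / fact n * alpha * alpha ^ i) sums (x ^ n / fact n * alpha * (1 / (1 - alpha)))"
    by (rule sums_mult)
  have "cmod (exp z) \<le> x ^ n / fact n * alpha * (1 / (1 - alpha))"
  proof (rule norm_sums_le[OF tail geo])
    fix i
    have "cmod (z ^ (i + Suc n) / fact (i + Suc n)) = cmod z ^ (n + Suc i) / fact (n + Suc i)"
    proof -
      have "i + Suc n = n + Suc i" by simp
      thus ?thesis by (simp only: norm_divide norm_power norm_fact)
    qed
    also have "\<dots> \<le> x ^ (n + Suc i) / fact (n + Suc i)"
      using x by (intro divide_right_mono power_mono) auto
    also have "\<dots> \<le> x ^ n / fact n * alpha ^ Suc i" by (rule ratio)
    finally show "cmod (z ^ (i + Suc n) / fact (i + Suc n)) \<le> x ^ n / fact n * alpha * alpha ^ i"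
      by (simp add: mult.assoc)
  qed
  also have "\<dots> < x ^ n / fact n"
  proof -
    have "alpha * (1 / (1 - alpha)) < 1" using alpha_less_half by (simp add: divide_less_eq)
    moreover have "x ^ n / fact n > 0" using n alpha_pos by (simp add: x_def)
    ultimately have "x ^ n / fact n * (alpha * (1 / (1 - alpha))) < x ^ n / fact n * 1"
      by (rule mult_strict_left_mono)
    thus ?thesis by (simp only: mult.assoc mult_1_right)
  qed
  also have "\<dots> \<le> exp (- x)"
  proof -
    have "alpha = exp (- (1 + alpha))"
      unfolding exp_minus using alpha_eq by (metis inverse_unique mult.commute)
    hence "x = real n * exp (- (1 + alpha))" unfolding x_def by simp
    hence "x ^ n / fact n = real n ^ n / fact n * exp (- (real n * (1 + alpha)))"
      by (simp add: power_mult_distrib exp_of_nat_mult[symmetric] algebra_simps)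
    also have "\<dots> \<le> exp (real n) * exp (- (real n * (1 + alpha)))"
      by (intro mult_right_mono power_over_fact_le_exp) auto
    also have "\<dots> = exp (- x)" by (simp add: x_def exp_add[symmetric] algebra_simps)
    finally show ?thesis .
  qed
  also have "\<dots> \<le> cmod (exp z)"
    using x abs_Re_le_cmod[of z] by simp
  finally show False by simp
qed

text \<open>
  Composition with the truncated exponential series: its $k$-th coefficient divided by
  ${n \choose k}$ is $(n-k)!/n!$.
\<close>

lemma falling_factorial_division_nonzero:
  fixes c :: "nat \<Rightarrow> complex"
  assumes n: "n \<ge> 1" and c: "\<And>s. cmod s \<le> R \<Longrightarrow> (\<Sum>k\<le>n. c k * s ^ k) \<noteq> 0"
    and s: "cmod s \<le> R * (alpha * real n)"
  shows "(\<Sum>k\<le>n. c k * (fact (n - k) / fact n) * s ^ k) \<noteq> 0"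
proof -
  define b :: complex where "b = of_real (alpha * real n)"
  have bpos: "alpha * real n > 0" using alpha_pos n by simp
  hence nb: "cmod b = alpha * real n" unfolding b_def norm_of_real by (rule abs_of_pos)
  hence b0: "b \<noteq> 0" using bpos by auto
  define u where "u = s / b"
  have u: "cmod u \<le> R" "s = b * u" using s bpos b0 nb by (simp_all add: u_def norm_divide divide_le_eq)
  define q where "q = (\<Sum>k\<le>n. monom (b ^ k / fact k) k)"
  define a where "a k = c k * u ^ k / of_nat (n choose k)" for k
  have "(\<Sum>k\<le>n. coeff q k * a k) \<noteq> 0"
  proof (rule Szego_composition)
    show "degree q \<le> n" unfolding q_def by (intro degree_sum_le) (auto intro: order.trans[OF degree_monom_le])
    show "poly q z \<noteq> 0" if z: "cmod z \<le> 1" for z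
    proof -
      have "cmod (b * z) \<le> alpha * real n"
        using z bpos by (simp add: norm_mult nb mult_left_le)
      from truncated_exp_nonzero[OF n this] show ?thesis
        by (simp add: q_def poly_sum poly_monom power_mult_distrib)
    qed
    show "poly (binomial_poly n a) z \<noteq> 0" if z: "cmod z \<le> 1" for z
    proof -
      have "cmod (u * z) \<le> R" using u z mult_left_le[of "cmod z" "cmod u"] by (simp add: norm_mult)
      moreover have "poly (binomial_poly n a) z = (\<Sum>k\<le>n. c k * (u * z) ^ k)"
        unfolding poly_binomial_poly a_def by (intro sum.cong) (auto simp: power_mult_distrib)
      ultimately show ?thesis using c by simp
    qed
  qed
  also have "(\<Sum>k\<le>n. coeff q k * a k) = (\<Sum>k\<le>n. c k * (fact (n - k) / fact n) * s ^ k)"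
  proof (rule sum.cong[OF refl])
    fix k assume "k \<in> {..n}"
    hence k: "k \<le> n" by simp
    hence "coeff q k = b ^ k / fact k" by (simp add: q_def coeff_sum)
    thus "coeff q k * a k = c k * (fact (n - k) / fact n) * s ^ k"
      using k by (simp add: a_def u(2) binomial_fact power_mult_distrib)
  qed
  finally show ?thesis .
qed

section \<open>Matchings in weighted hypergraphs\<close>

text \<open>
  Edges are labels \<open>e\<close> with vertex sets \<open>V e\<close>, so that weights and products can be indexed by any
  type of edge. The set \<open>S\<close> consists of the vertices that may be covered.
\<close>

definition matchings :: "('e \<Rightarrow> 'v set) \<Rightarrow> 'e set \<Rightarrow> 'v set \<Rightarrow> 'e set set" where
  "matchings V E S = {M. M \<subseteq> E \<and> (\<forall>e\<in>M. V e \<subseteq> S) \<and> pairwise (\<lambda>e f. disjnt (V e) (V f)) M}"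

definition matching_sum :: "('e \<Rightarrow> 'v set) \<Rightarrow> 'e set \<Rightarrow> ('e \<Rightarrow> complex) \<Rightarrow> 'v set \<Rightarrow> complex" where
  "matching_sum V E w S = (\<Sum>M\<in>matchings V E S. \<Prod>e\<in>M. w e)"

lemma finite_matchings: "finite E \<Longrightarrow> finite (matchings V E S)"
  by (rule finite_subset[of _ "Pow E"]) (auto simp: matchings_def)

lemma matchings_split:
  assumes v: "v \<in> S"
  shows "matchings V E S = matchings V E (S - {v}) \<union>
    (\<Union>e\<in>{e \<in> E. v \<in> V e \<and> V e \<subseteq> S}. insert e ` matchings V E (S - V e))"
    (is "?L = ?A \<union> ?B")
proof (rule set_eqI, rule iffI)
  fix M assume M: "M \<in> ?L"
  show "M \<in> ?A \<union> ?B"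
  proof (cases "\<exists>e\<in>M. v \<in> V e")
    case True
    then obtain e where e: "e \<in> M" "v \<in> V e" by blast
    have "V f \<subseteq> S - V e" if "f \<in> M" "f \<noteq> e" for f
    proof -
      have "disjnt (V f) (V e)" "V f \<subseteq> S"
        using M e(1) that unfolding matchings_def by (blast dest: pairwiseD)+
      thus ?thesis by (auto simp: disjnt_iff)
    qed
    moreover have "pairwise (\<lambda>e f. disjnt (V e) (V f)) (M - {e})"
      using M pairwise_subset[of _ M "M - {e}"] by (simp add: matchings_def)
    ultimately have "M - {e} \<in> matchings V E (S - V e)"
      using M unfolding matchings_def by blast
    moreover have "e \<in> {e \<in> E. v \<in> V e \<and> V e \<subseteq> S}"
      using M e by (auto simp: matchings_def)
    moreover have "M = insert e (M - {e})" using e by blast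
    ultimately have "M \<in> ?B" by blast
    thus ?thesis ..
  next
    case False
    thus ?thesis using M by (auto simp: matchings_def)
  qed
next
  fix M assume "M \<in> ?A \<union> ?B"
  thus "M \<in> ?L"
  proof
    assume "M \<in> ?A" thus ?thesis by (auto simp: matchings_def)
  next
    assume "M \<in> ?B"
    then obtain e N where eN: "e \<in> E" "V e \<subseteq> S" "M = insert e N" "N \<in> matchings V E (S - V e)" by blast
    have "disjnt (V e) (V f)" "disjnt (V f) (V e)" if "f \<in> N" for f
      using eN(4) that by (auto simp: matchings_def disjnt_iff)
    thus ?thesis using eN by (auto simp: matchings_def pairwise_insert)
  qed
qed

text \<open>
  The vertex \<open>v\<close> is either uncovered or covered by exactly one edge.
\<close>

lemma matching_sum_vertex_recurrence:
  assumes E: "finite E" and v: "v \<in> S"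
  shows "matching_sum V E w S = matching_sum V E w (S - {v}) +
    (\<Sum>e\<in>{e \<in> E. v \<in> V e \<and> V e \<subseteq> S}. w e * matching_sum V E w (S - V e))"
proof -
  let ?Ev = "{e \<in> E. v \<in> V e \<and> V e \<subseteq> S}"
  have fin: "finite (matchings V E T)" for T using E by (rule finite_matchings)
  have notin: "e \<notin> M" if "M \<in> matchings V E (S - V e)" "e \<in> ?Ev" for M e
    using that by (auto simp: matchings_def)
  have "matching_sum V E w S = matching_sum V E w (S - {v}) +
     (\<Sum>M\<in>(\<Union>e\<in>?Ev. insert e ` matchings V E (S - V e)). prod w M)"
    unfolding matching_sum_def matchings_split[OF v]
    using E fin v by (intro sum.union_disjoint) (auto simp: matchings_def)
  also have "(\<Sum>M\<in>(\<Union>e\<in>?Ev. insert e ` matchings V E (S - V e)). prod w M) =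
    (\<Sum>e\<in>?Ev. \<Sum>M\<in>insert e ` matchings V E (S - V e). prod w M)"
  proof (intro sum.UNION_disjoint ballI impI)
    fix e f assume ef: "e \<in> ?Ev" "f \<in> ?Ev" "e \<noteq> f"
    have False if "M \<in> matchings V E (S - V e)" "N \<in> matchings V E (S - V f)"
      "insert e M = insert f N" for M N
    proof -
      have "f \<in> M" using that(3) ef(3) by (metis insertE insertI1)
      hence "V f \<subseteq> S - V e" using that(1) by (simp add: matchings_def)
      thus False using ef(1,2) by blast
    qed
    thus "insert e ` matchings V E (S - V e) \<inter> insert f ` matchings V E (S - V f) = {}"
      by blast
  qed (use E fin in auto)
  also have "\<dots> = (\<Sum>e\<in>?Ev. w e * matching_sum V E w (S - V e))"
  proof (rule sum.cong[OF refl])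
    fix e assume e: "e \<in> ?Ev"
    have "inj_on (insert e) (matchings V E (S - V e))"
      using notin[OF _ e] by (meson inj_onI insert_ident)
    hence "(\<Sum>M\<in>insert e ` matchings V E (S - V e). prod w M) =
       (\<Sum>M\<in>matchings V E (S - V e). prod w (insert e M))"
      by (simp add: sum.reindex o_def)
    also have "\<dots> = (\<Sum>M\<in>matchings V E (S - V e). w e * prod w M)"
    proof (rule sum.cong[OF refl])
      fix M assume M: "M \<in> matchings V E (S - V e)"
      hence "finite M" using E by (auto simp: matchings_def intro: finite_subset)
      thus "prod w (insert e M) = w e * prod w M" using notin[OF M e] by simp
    qed
    finally show "(\<Sum>M\<in>insert e ` matchings V E (S - V e). prod w M) = w e * matching_sum V E w (S - V e)"
      by (simp add: matching_sum_def sum_distrib_left)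
  qed
  finally show ?thesis .
qed

text \<open>
  Put $c = 1 - 1/d$. The induction carries the ratio bound $c |Z(S - v)| \le |Z(S)|$ along with
  $Z(S) \ne 0$. An edge at $v$ removes $d - 1$ further vertices, so the ratio bound for smaller sets
  gives $|Z(S - e)| \le c^{-(d-1)} |Z(S - v)|$, and the weight condition, whose right-hand side is
  $c^{d-1}/d$, bounds the sum over the edges at $v$ by $|Z(S - v)|/d$.
\<close>

lemma matching_sum_nonzero:
  assumes E: "finite E" and d: "d \<ge> 2" and V: "\<And>e. e \<in> E \<Longrightarrow> finite (V e) \<and> card (V e) = d"
    and w: "\<And>v. (\<Sum>e\<in>{e \<in> E. v \<in> V e}. cmod (w e)) \<le> real (d - 1) ^ (d - 1) / real d ^ d"
    and S: "finite S"
  shows "matching_sum V E w S \<noteq> 0"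
proof -
  define c :: real where "c = 1 - 1 / real d"
  have c: "0 < c" using d by (simp add: c_def)
  have cd: "real (d - 1) ^ (d - 1) / real d ^ d = c ^ (d - 1) / real d"
  proof -
    have "c = real (d - 1) / real d" using d by (simp add: c_def of_nat_diff field_simps)
    thus ?thesis using d by (cases d) (simp_all add: power_divide)
  qed
  let ?Z = "matching_sum V E w"
  have "?Z S \<noteq> 0 \<and> (\<forall>v\<in>S. c * cmod (?Z (S - {v})) \<le> cmod (?Z S))"
    using S
  proof (induction "card S" arbitrary: S rule: less_induct)
    case less
    \<comment> \<open>Removing the vertices of \<open>U\<close> one at a time from a proper subset of \<open>S\<close>.\<close>
    have smaller: "c ^ card U * cmod (?Z (T - U)) \<le> cmod (?Z T)"
      if "finite U" "U \<subseteq> T" "T \<subset> S" for U T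
      using that
    proof (induction U arbitrary: T rule: finite_induct)
      case empty thus ?case by simp
    next
      case (insert u U)
      have "finite T" "card T < card S" using insert.prems less.prems
        by (auto intro: finite_subset psubset_card_mono)
      hence "c * cmod (?Z (T - {u})) \<le> cmod (?Z T)" using less.hyps[of T] insert.prems by auto
      moreover have "c ^ card U * cmod (?Z (T - {u} - U)) \<le> cmod (?Z (T - {u}))"
        using insert.prems insert.hyps by (intro insert.IH) auto
      moreover have "T - {u} - U = T - insert u U" by auto
      ultimately have "c * (c ^ card U * cmod (?Z (T - insert u U))) \<le> cmod (?Z T)"
        using c by (simp only:) (rule order.trans[OF mult_left_mono], auto)
      thus ?case using insert.hyps by (simp add: mult.assoc)
    qed
    have key: "c * cmod (?Z (S - {v})) \<le> cmod (?Z S)" if v: "v \<in> S" for v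
    proof -
      let ?Ev = "{e \<in> E. v \<in> V e \<and> V e \<subseteq> S}"
      let ?z = "cmod (?Z (S - {v}))"
      have "cmod (\<Sum>e\<in>?Ev. w e * ?Z (S - V e)) \<le> (\<Sum>e\<in>?Ev. cmod (w e) * (?z / c ^ (d - 1)))"
      proof (rule sum_norm_le)
        fix e assume e: "e \<in> ?Ev"
        have cd1: "card (V e - {v}) = d - 1" using e V by simp
        have "S - {v} - (V e - {v}) = S - V e" using e by auto
        hence "c ^ (d - 1) * cmod (?Z (S - V e)) \<le> ?z"
          using smaller[of "V e - {v}" "S - {v}"] e v V cd1 by auto
        hence "cmod (?Z (S - V e)) \<le> ?z / c ^ (d - 1)" using c by (simp add: field_simps)
        thus "cmod (w e * ?Z (S - V e)) \<le> cmod (w e) * (?z / c ^ (d - 1))"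
          unfolding norm_mult by (rule mult_left_mono) simp
      qed
      also have "\<dots> = (\<Sum>e\<in>?Ev. cmod (w e)) * (?z / c ^ (d - 1))" by (rule sum_distrib_right[symmetric])
      also have "\<dots> \<le> c ^ (d - 1) / real d * (?z / c ^ (d - 1))"
      proof (rule mult_right_mono)
        have "(\<Sum>e\<in>?Ev. cmod (w e)) \<le> (\<Sum>e\<in>{e \<in> E. v \<in> V e}. cmod (w e))"
          using E by (intro sum_mono2) auto
        also have "\<dots> \<le> c ^ (d - 1) / real d" unfolding cd[symmetric] by (rule w)
        finally show "(\<Sum>e\<in>?Ev. cmod (w e)) \<le> c ^ (d - 1) / real d" .
      qed (use c in auto)
      also have "\<dots> = ?z / real d" using c by simp
      finally have "cmod (\<Sum>e\<in>?Ev. w e * ?Z (S - V e)) \<le> ?z / real d" .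
      moreover have "?z - cmod (\<Sum>e\<in>?Ev. w e * ?Z (S - V e)) \<le> cmod (?Z S)"
        unfolding matching_sum_vertex_recurrence[OF E v, of V w] by (rule norm_diff_ineq)
      ultimately show ?thesis by (simp add: c_def left_diff_distrib)
    qed
    have "?Z S \<noteq> 0"
    proof (cases "S = {}")
      case True
      have "e \<notin> E \<or> \<not> V e \<subseteq> {}" for e using V[of e] d by auto
      hence "matchings V E {} = {{}}" unfolding matchings_def by (auto simp: pairwise_def)
      thus ?thesis using True by (simp add: matching_sum_def)
    next
      case False
      then obtain v where v: "v \<in> S" by blast
      hence "?Z (S - {v}) \<noteq> 0"
        using less.hyps[of "S - {v}"] less.prems card_Diff1_less[of S v] by blast
      thus ?thesis using key[OF v] c by (auto simp: mult_le_0_iff)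
    qed
    thus ?case using key by blast
  qed
  thus ?thesis by blast
qed

section \<open>Expansion of the permanent around the all-ones tensor\<close>

lemma card_pointwise_lists:
  assumes "\<And>k. k < m \<Longrightarrow> finite (B k)"
  shows "finite {xs. length xs = m \<and> (\<forall>k<m. xs ! k \<in> B k)} \<and>
    card {xs. length xs = m \<and> (\<forall>k<m. xs ! k \<in> B k)} = (\<Prod>k<m. card (B k))"
  using assms
proof (induction m)
  case 0
  have "{xs. length xs = 0 \<and> (\<forall>k<0. xs ! k \<in> B k)} = {[]}" by auto
  thus ?case by simp
next
  case (Suc m)
  let ?S = "\<lambda>m. {xs. length xs = m \<and> (\<forall>k<m. xs ! k \<in> B k)}"
  have S: "?S (Suc m) = (\<lambda>(xs, x). xs @ [x]) ` (?S m \<times> B m)"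
  proof (rule set_eqI, rule iffI)
    fix xs assume xs: "xs \<in> ?S (Suc m)"
    then obtain ys y where "xs = ys @ [y]" by (metis (mono_tags) length_Suc_conv_rev mem_Collect_eq)
    thus "xs \<in> (\<lambda>(xs, x). xs @ [x]) ` (?S m \<times> B m)"
      using xs by (auto simp: nth_append image_iff split: if_splits)
  next
    fix xs assume "xs \<in> (\<lambda>(xs, x). xs @ [x]) ` (?S m \<times> B m)"
    thus "xs \<in> ?S (Suc m)" by (auto simp: nth_append less_Suc_eq)
  qed
  have inj: "inj_on (\<lambda>(xs, x). xs @ [x]) (?S m \<times> B m)" by (auto simp: inj_on_def)
  have fin: "finite (?S m)" "card (?S m) = (\<Prod>k<m. card (B k))" using Suc by auto
  show ?case unfolding S card_image[OF inj] card_cartesian_product fin(2)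
    using fin(1) Suc.prems by (simp add: mult.commute)
qed

text \<open>
  Fixing one extension $\sigma$ of $f$, the others are $\sigma \circ \rho$ with $\rho$ a permutation
  of the complement of \<open>T\<close>.
\<close>

lemma card_permutations_extending:
  assumes A: "finite A" and T: "T \<subseteq> A" and f: "inj_on f T" "f ` T \<subseteq> A"
  shows "card {\<pi>. \<pi> permutes A \<and> (\<forall>i\<in>T. \<pi> i = f i)} = fact (card A - card T)"
proof -
  have fT: "finite T" using A T finite_subset by blast
  have "card (A - T) = card (A - f ` T)"
    using A T f fT by (simp add: card_Diff_subset card_image)
  then obtain h where h: "bij_betw h (A - T) (A - f ` T)"
    using A finite_same_card_bij[of "A - T" "A - f ` T"] by auto
  \<comment> \<open>An arbitrary bijection between the complements extends \<open>f\<close> to a permutation.\<close>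
  define \<sigma> where "\<sigma> x = (if x \<in> T then f x else if x \<in> A then h x else x)" for x
  have "bij_betw \<sigma> (T \<union> (A - T)) (f ` T \<union> (A - f ` T))"
  proof (rule bij_betw_combine)
    show "bij_betw \<sigma> T (f ` T)" using f by (auto simp: \<sigma>_def bij_betw_def inj_on_def)
    show "bij_betw \<sigma> (A - T) (A - f ` T)" 
      using h by (subst bij_betw_cong[of _ _ h]) (auto simp: \<sigma>_def)
  qed auto
  hence "bij_betw \<sigma> A A" using T f by (simp add: Un_absorb1)
  hence \<sigma>: "\<sigma> permutes A" using T by (intro bij_imp_permutes) (auto simp: \<sigma>_def)
  have "{\<pi>. \<pi> permutes A \<and> (\<forall>i\<in>T. \<pi> i = f i)} = (\<circ>) \<sigma> ` {\<rho>. \<rho> permutes (A - T)}"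
  proof (rule set_eqI, rule iffI)
    fix \<pi> assume \<pi>: "\<pi> \<in> {\<pi>. \<pi> permutes A \<and> (\<forall>i\<in>T. \<pi> i = f i)}"
    have "(inv \<sigma> \<circ> \<pi>) permutes A" using \<pi> \<sigma> by (auto intro: permutes_compose permutes_inv)
    moreover have "(inv \<sigma> \<circ> \<pi>) i = i" if "i \<in> T" for i
    proof -
      have "\<pi> i = \<sigma> i" using \<pi> that by (simp add: \<sigma>_def)
      thus ?thesis using permutes_inverses(2)[OF \<sigma>] by simp
    qed
    ultimately have "(inv \<sigma> \<circ> \<pi>) permutes (A - T)"
      using permutes_superset[of "inv \<sigma> \<circ> \<pi>" A "A - T"] by (auto simp del: o_apply)
    moreover have "\<pi> = \<sigma> \<circ> (inv \<sigma> \<circ> \<pi>)" using permutes_inverses(1)[OF \<sigma>] by (simp add: fun_eq_iff)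
    ultimately show "\<pi> \<in> (\<circ>) \<sigma> ` {\<rho>. \<rho> permutes (A - T)}" by blast
  next
    fix \<pi> assume "\<pi> \<in> (\<circ>) \<sigma> ` {\<rho>. \<rho> permutes (A - T)}"
    then obtain \<rho> where \<rho>: "\<rho> permutes (A - T)" "\<pi> = \<sigma> \<circ> \<rho>" by blast
    have "\<pi> permutes A" unfolding \<rho>(2)
      using \<sigma> permutes_subset[OF \<rho>(1)] by (auto intro: permutes_compose)
    moreover have "\<pi> i = f i" if "i \<in> T" for i
      using that \<rho> permutes_not_in[OF \<rho>(1), of i] by (simp add: \<sigma>_def)
    ultimately show "\<pi> \<in> {\<pi>. \<pi> permutes A \<and> (\<forall>i\<in>T. \<pi> i = f i)}" by simp
  qed
  moreover have "inj_on ((\<circ>) \<sigma>) {\<rho>. \<rho> permutes (A - T)}"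
    using fun.inj_map[OF permutes_inj[OF \<sigma>]] by (rule inj_on_subset) simp
  moreover have "card {\<rho>. \<rho> permutes (A - T)} = fact (card (A - T))"
    using A by (intro card_permutations) auto
  ultimately show ?thesis using A T fT by (simp add: card_image card_Diff_subset)
qed

text \<open>
  These are the matchings of the complete $d$-partite hypergraph: two distinct index lists in such a
  set differ in every position.
\<close>

definition partial_diagonals :: "nat \<Rightarrow> nat \<Rightarrow> nat list set set" where
  "partial_diagonals d n = {M. M \<subseteq> tensor_indices d n \<and> (\<forall>k<d. inj_on (\<lambda>e. e ! k) M)}"

lemma finite_tensor_indices: "finite (tensor_indices d n)"
  using finite_lists_length_eq[of "{1..n}" d] by (simp add: tensor_indices_def conj_commute)

lemma finite_partial_diagonals: "finite (partial_diagonals d n)"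
  by (rule finite_subset[of _ "Pow (tensor_indices d n)"])
    (auto simp: partial_diagonals_def finite_tensor_indices)

lemma card_partial_diagonal_le:
  assumes "M \<in> partial_diagonals d n" "d \<ge> 1"
  shows "card M \<le> n"
proof -
  have "e ! 0 \<in> {1..n}" if "e \<in> M" for e
    using assms that nth_mem[of 0 e] by (auto simp: partial_diagonals_def tensor_indices_def subset_iff)
  hence sub: "(\<lambda>e. e ! 0) ` M \<subseteq> {1..n}" by blast
  have "card M = card ((\<lambda>e. e ! 0) ` M)"
    using assms by (intro card_image[symmetric]) (auto simp: partial_diagonals_def)
  also have "\<dots> \<le> card {1..n}"
    by (intro card_mono sub) simp
  finally show ?thesis by simp
qed

definition diagonal :: "nat \<Rightarrow> (nat \<Rightarrow> nat) list \<Rightarrow> nat list set" where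
  "diagonal n \<pi>s = (\<lambda>i. i # map (\<lambda>\<pi>. \<pi> i) \<pi>s) ` {1..n}"

text \<open>
  The conditions on the $d - 1$ permutations are independent, and each prescribes the values of one
  permutation on a set of size $|M|$.
\<close>

lemma card_diagonals_extending:
  assumes M: "M \<in> partial_diagonals d n" and d: "d \<ge> 1"
  shows "card {\<pi>s. length \<pi>s = d - 1 \<and> set \<pi>s \<subseteq> {\<pi>. \<pi> permutes {1..n}} \<and> M \<subseteq> diagonal n \<pi>s}
    = fact (n - card M) ^ (d - 1)"
proof -
  let ?T = "(\<lambda>e. e ! 0) ` M"
  have inj: "inj_on (\<lambda>e. e ! k) M" if "k < d" for k using M that by (auto simp: partial_diagonals_def)
  have inj0: "inj_on (\<lambda>e. e ! 0) M" using inj d by simp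
  have "e \<in> tensor_indices d n" if "e \<in> M" for e
    using M that by (auto simp: partial_diagonals_def)
  hence len: "length e = d" and rng: "k < d \<Longrightarrow> e ! k \<in> {1..n}" if "e \<in> M" for e k
    using that nth_mem[of k e] by (auto simp: tensor_indices_def subset_iff)
  define g where "g = the_inv_into M (\<lambda>e. e ! 0)"
  have g: "g (e ! 0) = e" if "e \<in> M" for e
    unfolding g_def by (rule the_inv_into_f_f[OF inj0 that])
  define B where "B k = {\<pi>. \<pi> permutes {1..n} \<and> (\<forall>i\<in>?T. \<pi> i = g i ! Suc k)}" for k
  have cB: "card (B k) = fact (n - card M)" if k: "k < d - 1" for k
  proof -
    have "card (B k) = fact (card {1..n} - card ?T)"
      unfolding B_def
    proof (rule card_permutations_extending)
      show "?T \<subseteq> {1..n}" using rng d by auto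
      show "inj_on (\<lambda>i. g i ! Suc k) ?T"
      proof (rule inj_onI)
        fix i j assume "i \<in> ?T" "j \<in> ?T" and eq: "g i ! Suc k = g j ! Suc k"
        then obtain e f where ef: "e \<in> M" "f \<in> M" "i = e ! 0" "j = f ! 0" by blast
        hence "e = f" using eq k g inj_onD[OF inj[of "Suc k"], of e f] by simp
        thus "i = j" using ef by simp
      qed
      show "(\<lambda>i. g i ! Suc k) ` ?T \<subseteq> {1..n}" using rng[of _ "Suc k"] k g by auto
    qed simp
    thus ?thesis using inj0 by (simp add: card_image)
  qed
  have fB: "finite (B k)" for k
    by (rule finite_subset[OF _ finite_permutations[of "{1..n}"]]) (auto simp: B_def)
  have mem: "e \<in> diagonal n \<pi>s \<longleftrightarrow> (\<forall>k<d - 1. (\<pi>s ! k) (e ! 0) = e ! Suc k)"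
    if e: "e \<in> M" and l: "length \<pi>s = d - 1" for e \<pi>s
  proof -
    obtain x xs where x: "e = x # xs" using len[OF e] d by (cases e) auto
    have "e \<in> diagonal n \<pi>s \<longleftrightarrow> xs = map (\<lambda>\<pi>. \<pi> x) \<pi>s"
      using rng[OF e, of 0] d unfolding x diagonal_def by auto
    also have "\<dots> \<longleftrightarrow> (\<forall>k<d - 1. (\<pi>s ! k) (e ! 0) = e ! Suc k)"
      using len[OF e] l unfolding x by (auto simp: list_eq_iff_nth_eq)
    finally show ?thesis .
  qed
  have "{\<pi>s. length \<pi>s = d - 1 \<and> set \<pi>s \<subseteq> {\<pi>. \<pi> permutes {1..n}} \<and> M \<subseteq> diagonal n \<pi>s}
    = {\<pi>s. length \<pi>s = d - 1 \<and> (\<forall>k<d - 1. \<pi>s ! k \<in> B k)}"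
  proof (rule Collect_cong, rule conj_cong[OF refl])
    fix \<pi>s :: "(nat \<Rightarrow> nat) list" assume l: "length \<pi>s = d - 1"
    have "set \<pi>s \<subseteq> {\<pi>. \<pi> permutes {1..n}} \<longleftrightarrow> (\<forall>k<d - 1. \<pi>s ! k permutes {1..n})"
      unfolding l[symmetric] subset_iff mem_Collect_eq by (metis in_set_conv_nth)
    moreover have "M \<subseteq> diagonal n \<pi>s \<longleftrightarrow> (\<forall>k<d - 1. \<forall>i\<in>?T. (\<pi>s ! k) i = g i ! Suc k)"
      using mem[OF _ l] g by (auto simp: subset_iff)
    ultimately show "set \<pi>s \<subseteq> {\<pi>. \<pi> permutes {1..n}} \<and> M \<subseteq> diagonal n \<pi>s \<longleftrightarrow> (\<forall>k<d - 1. \<pi>s ! k \<in> B k)"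
      unfolding B_def by auto
  qed
  thus ?thesis using card_pointwise_lists[of "d - 1" B] fB cB by simp
qed

lemma diagonal_partial_diagonals:
  assumes "length \<pi>s = d - 1" "set \<pi>s \<subseteq> {\<pi>. \<pi> permutes {1..n}}" "M \<subseteq> diagonal n \<pi>s" "d \<ge> 1"
  shows "M \<in> partial_diagonals d n"
proof -
  have perm: "(\<pi>s ! k) permutes {1..n}" if "k < d - 1" for k
  proof -
    have "\<pi>s ! k \<in> set \<pi>s" using assms(1) that by simp
    thus ?thesis using assms(2) by blast
  qed
  have "diagonal n \<pi>s \<subseteq> tensor_indices d n"
    using assms(1,2,4) permutes_in_image[of _ "{1..n}"]
    by (fastforce simp: diagonal_def tensor_indices_def)
  moreover have "inj_on (\<lambda>e. e ! k) (diagonal n \<pi>s)" if k: "k < d" for k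
  proof (cases k)
    case 0 thus ?thesis by (auto simp: diagonal_def inj_on_def)
  next
    case (Suc j)
    thus ?thesis using k assms(1) perm[of j] permutes_inj[of "\<pi>s ! j" "{1..n}"]
      by (auto simp: diagonal_def inj_on_def)
  qed
  ultimately show ?thesis using assms(3) inj_on_subset[OF _ assms(3)]
    by (auto simp: partial_diagonals_def)
qed

text \<open>
  Each factor is written as $a_e = (a_e - 1) + 1$ and the products are multiplied out. After the two
  sums are exchanged, a partial diagonal is counted once for every diagonal that contains it.
\<close>

lemma PER_expansion:
  assumes d: "d \<ge> 1"
  shows "PER d n A = (\<Sum>M\<in>partial_diagonals d n. fact (n - card M) ^ (d - 1) * (\<Prod>e\<in>M. A e - 1))"
proof -
  let ?P = "{\<pi>s. length \<pi>s = d - 1 \<and> set \<pi>s \<subseteq> {\<pi>. \<pi> permutes {1..n}}}"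
  have fP: "finite ?P"
    using finite_lists_length_eq[OF finite_permutations[of "{1..n}"], of "d - 1"]
    by (simp add: conj_commute)
  have "PER d n A = (\<Sum>\<pi>s\<in>?P. \<Prod>e\<in>diagonal n \<pi>s. A e)"
    unfolding PER_def diagonal_def
    by (intro sum.cong refl, subst prod.reindex) (auto simp: inj_on_def)
  also have "\<dots> = (\<Sum>\<pi>s\<in>?P. \<Sum>M\<in>Pow (diagonal n \<pi>s). \<Prod>e\<in>M. A e - 1)"
  proof (rule sum.cong[OF refl])
    fix \<pi>s
    have "finite (diagonal n \<pi>s)" by (simp add: diagonal_def)
    from prod_add[OF this, of "\<lambda>e. A e - 1" "\<lambda>_. 1"]
    show "(\<Prod>e\<in>diagonal n \<pi>s. A e) = (\<Sum>M\<in>Pow (diagonal n \<pi>s). \<Prod>e\<in>M. A e - 1)" by simp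
  qed
  also have "\<dots> = (\<Sum>\<pi>s\<in>?P. \<Sum>M\<in>partial_diagonals d n. if M \<subseteq> diagonal n \<pi>s then \<Prod>e\<in>M. A e - 1 else 0)"
  proof (rule sum.cong[OF refl])
    fix \<pi>s assume "\<pi>s \<in> ?P"
    hence "Pow (diagonal n \<pi>s) = partial_diagonals d n \<inter> {M. M \<subseteq> diagonal n \<pi>s}"
      using diagonal_partial_diagonals d by auto
    thus "(\<Sum>M\<in>Pow (diagonal n \<pi>s). \<Prod>e\<in>M. A e - 1) =
      (\<Sum>M\<in>partial_diagonals d n. if M \<subseteq> diagonal n \<pi>s then \<Prod>e\<in>M. A e - 1 else 0)"
      by (simp add: sum.inter_restrict finite_partial_diagonals)
  qed
  also have "\<dots> = (\<Sum>M\<in>partial_diagonals d n. \<Sum>\<pi>s\<in>?P. if M \<subseteq> diagonal n \<pi>s then \<Prod>e\<in>M. A e - 1 else 0)"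
    by (rule sum.swap)
  also have "\<dots> = (\<Sum>M\<in>partial_diagonals d n. fact (n - card M) ^ (d - 1) * (\<Prod>e\<in>M. A e - 1))"
  proof (rule sum.cong[OF refl])
    fix M assume M: "M \<in> partial_diagonals d n"
    have "(\<Sum>\<pi>s\<in>?P. if M \<subseteq> diagonal n \<pi>s then \<Prod>e\<in>M. A e - 1 else 0) =
      of_nat (card (?P \<inter> {\<pi>s. M \<subseteq> diagonal n \<pi>s})) * (\<Prod>e\<in>M. A e - 1)"
      using sum.inter_restrict[OF fP, of "\<lambda>_. \<Prod>e\<in>M. A e - 1" "{\<pi>s. M \<subseteq> diagonal n \<pi>s}"] by simp
    also have "?P \<inter> {\<pi>s. M \<subseteq> diagonal n \<pi>s} =
      {\<pi>s. length \<pi>s = d - 1 \<and> set \<pi>s \<subseteq> {\<pi>. \<pi> permutes {1..n}} \<and> M \<subseteq> diagonal n \<pi>s}" by auto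
    finally show "(\<Sum>\<pi>s\<in>?P. if M \<subseteq> diagonal n \<pi>s then \<Prod>e\<in>M. A e - 1 else 0) =
      fact (n - card M) ^ (d - 1) * (\<Prod>e\<in>M. A e - 1)"
      using card_diagonals_extending[OF M d] by simp
  qed
  finally show ?thesis .
qed

section \<open>The zero-free region\<close>

text \<open>
  A vertex is a pair of a position and the index found there, so the edges at a vertex form a slice.
\<close>

definition hyperedge :: "nat \<Rightarrow> nat list \<Rightarrow> (nat \<times> nat) set" where
  "hyperedge d e = (\<lambda>k. (k, e ! k)) ` {..<d}"

lemma disjnt_hyperedge: "disjnt (hyperedge d e) (hyperedge d f) \<longleftrightarrow> (\<forall>k<d. e ! k \<noteq> f ! k)"
  by (auto simp: hyperedge_def disjnt_iff)

lemma hyperedge_subset: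
  assumes "e \<in> tensor_indices d n"
  shows "hyperedge d e \<subseteq> {..<d} \<times> {1..n}"
proof -
  have "e ! k \<in> {1..n}" if "k < d" for k
    using assms that nth_mem[of k e] by (auto simp: tensor_indices_def subset_iff)
  thus ?thesis by (auto simp: hyperedge_def)
qed

lemma matchings_eq_partial_diagonals:
  "matchings (hyperedge d) (tensor_indices d n) ({..<d} \<times> {1..n}) = partial_diagonals d n"
proof -
  have "pairwise (\<lambda>e f. disjnt (hyperedge d e) (hyperedge d f)) M \<longleftrightarrow> (\<forall>k<d. inj_on (\<lambda>e. e ! k) M)" for M
    unfolding pairwise_def inj_on_def disjnt_hyperedge by blast
  thus ?thesis using hyperedge_subset unfolding matchings_def partial_diagonals_def by blast
qed

lemma sum_partial_diagonals_by_card: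
  fixes g :: "nat list set \<Rightarrow> complex"
  assumes "d \<ge> 1"
  shows "(\<Sum>M\<in>partial_diagonals d n. g M) = (\<Sum>k\<le>n. \<Sum>M\<in>{M \<in> partial_diagonals d n. card M = k}. g M)"
  using assms card_partial_diagonal_le
  by (intro sum.group[symmetric]) (auto simp: finite_partial_diagonals)

text \<open>
  By \<open>PER_expansion\<close> this polynomial in $t$ is the permanent of the tensor with entries
  $1 + t(a_e - 1)$.
\<close>

definition diagonal_poly :: "nat \<Rightarrow> nat \<Rightarrow> (nat list \<Rightarrow> complex) \<Rightarrow> complex poly" where
  "diagonal_poly d n A =
    (\<Sum>M\<in>partial_diagonals d n. monom (fact (n - card M) ^ (d - 1) * (\<Prod>e\<in>M. A e - 1)) (card M))"

lemma poly_diagonal_poly: "poly (diagonal_poly d n A) t =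
    (\<Sum>M\<in>partial_diagonals d n. fact (n - card M) ^ (d - 1) * (\<Prod>e\<in>M. A e - 1) * t ^ card M)"
  by (simp add: diagonal_poly_def poly_sum poly_monom)

lemma poly_diagonal_poly_1: "d \<ge> 1 \<Longrightarrow> poly (diagonal_poly d n A) 1 = PER d n A"
  by (simp add: poly_diagonal_poly PER_expansion)

lemma degree_diagonal_poly: "d \<ge> 1 \<Longrightarrow> degree (diagonal_poly d n A) \<le> n"
  unfolding diagonal_poly_def
  by (intro degree_sum_le)
    (auto intro: order.trans[OF degree_monom_le] simp: card_partial_diagonal_le finite_partial_diagonals)

lemma coeff_diagonal_poly: "coeff (diagonal_poly d n A) k =
    (\<Sum>M\<in>{M \<in> partial_diagonals d n. card M = k}. fact (n - k) ^ (d - 1) * (\<Prod>e\<in>M. A e - 1))"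
  unfolding diagonal_poly_def coeff_sum coeff_monom
  by (auto simp: finite_partial_diagonals sum.inter_filter intro!: sum.cong)

lemma finite_partial_diagonal: "M \<in> partial_diagonals d n \<Longrightarrow> finite M"
  using finite_subset[OF _ finite_tensor_indices] by (auto simp: partial_diagonals_def)

lemma coeff_diagonal_poly_0: "coeff (diagonal_poly d n A) 0 = fact n ^ (d - 1)"
proof -
  have "{M \<in> partial_diagonals d n. card M = 0} = {{}}"
    using finite_partial_diagonal by (auto simp: partial_diagonals_def)
  thus ?thesis by (simp add: coeff_diagonal_poly)
qed

text \<open>
  This is \<open>matching_sum_nonzero\<close> with slices as vertices.
\<close>

lemma matching_gf_partial_diagonals_nonzero:
  assumes d: "d \<ge> 2"
    and w: "\<And>k j. k < d \<Longrightarrow> j \<in> {1..n} \<Longrightarrow>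
      (\<Sum>e\<in>slice_indices d n k j. cmod (w e)) \<le> real (d - 1) ^ (d - 1) / real d ^ d"
  shows "(\<Sum>M\<in>partial_diagonals d n. \<Prod>e\<in>M. w e) \<noteq> 0"
proof -
  have "matching_sum (hyperedge d) (tensor_indices d n) w ({..<d} \<times> {1..n}) \<noteq> 0"
  proof (rule matching_sum_nonzero[OF finite_tensor_indices d])
    fix e show "finite (hyperedge d e) \<and> card (hyperedge d e) = d"
      by (auto simp: hyperedge_def card_image inj_on_def)
  next
    fix v :: "nat \<times> nat"
    obtain k j where v: "v = (k, j)" by (cases v)
    show "(\<Sum>e\<in>{e \<in> tensor_indices d n. v \<in> hyperedge d e}. cmod (w e)) \<le> real (d - 1) ^ (d - 1) / real d ^ d"
    proof (cases "v \<in> {..<d} \<times> {1..n}")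
      case True
      hence "{e \<in> tensor_indices d n. v \<in> hyperedge d e} = slice_indices d n k j"
        by (auto simp: v hyperedge_def slice_indices_def)
      thus ?thesis using w[of k j] True v by simp
    next
      case False
      hence "{e \<in> tensor_indices d n. v \<in> hyperedge d e} = {}" using hyperedge_subset by blast
      thus ?thesis by (simp only: sum.empty) simp
    qed
  qed simp
  thus ?thesis unfolding matching_sum_def matchings_eq_partial_diagonals .
qed

text \<open>
  Scaling the entries of $t(Z - J)$ by $(\alpha n)^{-(d-1)}$ turns the bound
  $\eta_d n^{d-1}$ on the slices into the bound $(d-1)^{d-1}/d^d$ for matching polynomials. Each
  of the $d - 1$ compositions with the truncated exponential series then introduces one factor
  $(n-k)!/n!$ and enlarges the zero-free disc by the factor $\alpha n$, which undoes the scaling.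
\<close>

lemma diagonal_poly_nonzero:
  assumes d: "d \<ge> 2" and n: "n \<ge> 1" and Z: "Z \<in> near_ones d n r"
    and t: "cmod t * r \<le> eta_max d"
  shows "poly (diagonal_poly d n Z) t \<noteq> 0"
proof -
  define b :: real where "b = (alpha * real n) ^ (d - 1)"
  have b: "b > 0" using alpha_pos n by (simp add: b_def)
  define w where "w e = t * (Z e - 1) / of_real b" for e
  define m where "m k = (\<Sum>M\<in>{M \<in> partial_diagonals d n. card M = k}. \<Prod>e\<in>M. w e)" for k
  have slice: "(\<Sum>e\<in>slice_indices d n k j. cmod (w e)) \<le> real (d - 1) ^ (d - 1) / real d ^ d"
    if "k < d" "j \<in> {1..n}" for k j
  proof -
    have "(\<Sum>e\<in>slice_indices d n k j. cmod (w e))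
        = cmod t * (\<Sum>e\<in>slice_indices d n k j. cmod (1 - Z e)) / b"
      unfolding sum_distrib_left sum_divide_distrib w_def using b
      by (intro sum.cong) (auto simp: norm_mult norm_divide norm_minus_commute)
    also have "\<dots> \<le> cmod t * (r * real n ^ (d - 1)) / b"
      using Z that b by (intro divide_right_mono mult_left_mono) (auto simp: near_ones_def)
    also have "\<dots> = cmod t * r / alpha ^ (d - 1)"
      using n by (simp add: b_def power_mult_distrib)
    also have "\<dots> \<le> eta_max d / alpha ^ (d - 1)"
      using t alpha_pos by (intro divide_right_mono) auto
    also have "\<dots> = real (d - 1) ^ (d - 1) / real d ^ d"
      using alpha_pos by (simp add: eta_max_def)
    finally show ?thesis .
  qed
  have by_card: "(\<Sum>k\<le>n. m k * g k) = (\<Sum>M\<in>partial_diagonals d n. (\<Prod>e\<in>M. w e) * g (card M))" for g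
    using d by (subst sum_partial_diagonals_by_card) (auto simp: m_def sum_distrib_right)
  have base: "(\<Sum>k\<le>n. m k * s ^ k) \<noteq> 0" if s: "cmod s \<le> 1" for s
  proof -
    have "(\<Sum>k\<le>n. m k * s ^ k) = (\<Sum>M\<in>partial_diagonals d n. \<Prod>e\<in>M. s * w e)"
      unfolding by_card by (simp add: prod.distrib mult.commute)
    also have "\<dots> \<noteq> 0"
    proof (rule matching_gf_partial_diagonals_nonzero[OF d])
      fix k j assume kj: "k < d" "j \<in> {1..n}"
      have "(\<Sum>e\<in>slice_indices d n k j. cmod (s * w e)) \<le> (\<Sum>e\<in>slice_indices d n k j. cmod (w e))"
        using s by (intro sum_mono) (simp add: norm_mult mult_left_le_one_le)
      thus "(\<Sum>e\<in>slice_indices d n k j. cmod (s * w e)) \<le> real (d - 1) ^ (d - 1) / real d ^ d"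
        using slice[OF kj] by simp
    qed
    finally show ?thesis .
  qed
  \<comment> \<open>After \<open>j\<close> compositions the zero-free disc has radius $(\alpha n)^j$.\<close>
  have "(\<Sum>k\<le>n. m k * (fact (n - k) / fact n) ^ j * s ^ k) \<noteq> 0" if "cmod s \<le> (alpha * real n) ^ j" for j s
    using that
  proof (induction j arbitrary: s)
    case 0 thus ?case using base by simp
  next
    case (Suc j)
    have "(\<Sum>k\<le>n. m k * (fact (n - k) / fact n) ^ j * (fact (n - k) / fact n) * s ^ k) \<noteq> 0"
      using Suc by (intro falling_factorial_division_nonzero[OF n, where R = "(alpha * real n) ^ j"])
        (auto simp: mult.commute)
    thus ?case by (simp add: mult_ac power_divide)
  qed
  from this[of "of_real b" "d - 1"]
  have nz: "(\<Sum>k\<le>n. m k * ((fact (n - k) / fact n) ^ (d - 1) * of_real b ^ k)) \<noteq> 0"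
    using b unfolding b_def[symmetric] mult.assoc norm_of_real by simp
  have "(\<Sum>k\<le>n. m k * ((fact (n - k) / fact n) ^ (d - 1) * of_real b ^ k))
      = poly (diagonal_poly d n Z) t / fact n ^ (d - 1)"
    unfolding by_card poly_diagonal_poly sum_divide_distrib
  proof (rule sum.cong[OF refl])
    fix M
    have "(\<Prod>e\<in>M. w e) * of_real b ^ card M = (\<Prod>e\<in>M. w e * of_real b)"
      by (simp add: prod.distrib)
    also have "\<dots> = (\<Prod>e\<in>M. (Z e - 1) * t)" using b by (simp add: w_def mult.commute)
    also have "\<dots> = (\<Prod>e\<in>M. Z e - 1) * t ^ card M" by (simp add: prod.distrib)
    finally have "(\<Prod>e\<in>M. w e) * of_real b ^ card M = (\<Prod>e\<in>M. Z e - 1) * t ^ card M" .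
    moreover have "(\<Prod>e\<in>M. w e) * ((fact (n - card M) / fact n) ^ (d - 1) * of_real b ^ card M) =
      ((\<Prod>e\<in>M. w e) * of_real b ^ card M) * fact (n - card M) ^ (d - 1) / fact n ^ (d - 1)"
      by (simp add: power_divide)
    ultimately show "(\<Prod>e\<in>M. w e) * ((fact (n - card M) / fact n) ^ (d - 1) * of_real b ^ card M) =
      fact (n - card M) ^ (d - 1) * (\<Prod>e\<in>M. Z e - 1) * t ^ card M / fact n ^ (d - 1)"
      by simp
  qed
  thus ?thesis using nz by auto
qed

section \<open>The logarithm as an integral along a segment\<close>

text \<open>
  The increment of $\ln f$ from 0 to 1. As an integral over a compact interval it is continuous in
  parameters of \<open>f\<close>.
\<close>

definition log_integral :: "complex poly \<Rightarrow> complex" where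
  "log_integral f = integral {0..1} (\<lambda>t::real. poly (pderiv f) (of_real t) / poly f (of_real t))"

lemma log_derivative_continuous:
  assumes "\<And>t. t \<in> {0..1} \<Longrightarrow> poly f (of_real t) \<noteq> 0"
  shows "continuous_on {0..1} (\<lambda>t::real. poly (pderiv f) (of_real t) / poly f (of_real t) :: complex)"
  using assms by (intro continuous_intros) auto

text \<open>
  With $G$ the integral up to $t$, the function $e^{-G(t)} f(t)$ has derivative zero.
\<close>

lemma exp_log_integral:
  fixes f :: "complex poly"
  assumes nz: "\<And>t. t \<in> {0..1} \<Longrightarrow> poly f (of_real t) \<noteq> 0"
  shows "poly f 0 * exp (log_integral f) = poly f 1"
proof -
  define \<phi> where "\<phi> t = poly (pderiv f) (of_real t) / poly f (of_real t)" for t :: real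
  define G where "G t = integral {0..t} \<phi>" for t
  have cont: "continuous_on {0..1} \<phi>" unfolding \<phi>_def using nz by (rule log_derivative_continuous)
  obtain c where c: "\<And>t. t \<in> {0..1} \<Longrightarrow> exp (- G t) * poly f (of_real t) = c"
  proof (rule has_vector_derivative_zero_constant)
    fix t :: real assume t: "t \<in> {0..1}"
    have G: "(G has_vector_derivative \<phi> t) (at t within {0..1})"
      unfolding G_def by (rule integral_has_vector_derivative[OF cont t])
    have e: "((\<lambda>t. exp (- G t)) has_vector_derivative (- \<phi> t * exp (- G t))) (at t within {0..1})"
      using field_vector_diff_chain_within[OF has_vector_derivative_minus[OF G], of exp "exp (- G t)"]
      by (simp add: o_def DERIV_exp has_field_derivative_at_within)
    have p: "((\<lambda>t. poly f (of_real t)) has_vector_derivative poly (pderiv f) (of_real t)) (at t within {0..1})"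
      by (rule has_vector_derivative_real_field) (rule poly_DERIV)
    have "((\<lambda>t. exp (- G t) * poly f (of_real t)) has_vector_derivative
       (exp (- G t) * poly (pderiv f) (of_real t) + - \<phi> t * exp (- G t) * poly f (of_real t))) (at t within {0..1})"
      by (rule has_vector_derivative_mult[OF e p])
    thus "((\<lambda>t. exp (- G t) * poly f (of_real t)) has_vector_derivative 0) (at t within {0..1})"
      using nz[OF t] by (simp add: \<phi>_def)
  qed (use that in auto)
  have "exp (- G 1) * poly f 1 = poly f 0"
    using c[of 0] c[of 1] by (simp add: G_def)
  moreover have "G 1 = log_integral f" by (simp add: G_def log_integral_def \<phi>_def[abs_def])
  ultimately show ?thesis by (simp add: exp_minus field_simps)
qed

lemma continuous_on_entry:
  "continuous_on S (\<lambda>p. fst p e)" for S :: "((nat list \<Rightarrow> complex) \<times> real) set"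
  by (rule continuous_on_compose2[OF continuous_on_product_coordinates continuous_on_fst])
    (auto intro: continuous_on_id)

text \<open>
  Continuity is that of a parameter integral, whose integrand is jointly continuous because
  \<open>diagonal_poly_nonzero\<close> still holds on the boundary of the region, at $|t| = 1$.
\<close>

lemma lnPER_branch_log_integral:
  assumes d: "d \<ge> 2" and n: "n \<ge> 1"
  shows "lnPER_branch d n (\<lambda>Z. of_real (ln (fact n ^ (d - 1))) + log_integral (diagonal_poly d n Z))"
proof -
  let ?D = "near_ones d n (eta_max d)"
  have nz: "poly (diagonal_poly d n Z) (of_real t) \<noteq> 0" if "Z \<in> ?D" "t \<in> {0..1}" for Z t
  proof (rule diagonal_poly_nonzero[OF d n that(1)])
    have "eta_max d \<ge> 0" using alpha_pos by (simp add: eta_max_def)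
    thus "cmod (of_real t) * eta_max d \<le> eta_max d" using that(2) by (simp add: mult_left_le_one_le)
  qed
  have p0: "poly (diagonal_poly d n Z) 0 = fact n ^ (d - 1)" for Z
    by (simp add: poly_0_coeff_0 coeff_diagonal_poly_0)
  have "continuous_on ?D (\<lambda>Z. log_integral (diagonal_poly d n Z))"
  proof -
    have c1: "continuous_on (?D \<times> {0..1}) (\<lambda>p. poly (diagonal_poly d n (fst p)) (of_real (snd p)))"
      unfolding poly_diagonal_poly by (intro continuous_intros continuous_on_entry)
    have c2: "continuous_on (?D \<times> {0..1}) (\<lambda>p. poly (pderiv (diagonal_poly d n (fst p))) (of_real (snd p)))"
      unfolding diagonal_poly_def higher_pderiv_sum[where n = 1, simplified] pderiv_monom poly_sum poly_monom
      by (intro continuous_intros continuous_on_entry)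
    have "continuous_on (?D \<times> cbox 0 1) (\<lambda>(Z, t). poly (pderiv (diagonal_poly d n Z)) (of_real t) /
        poly (diagonal_poly d n Z) (of_real t))"
      unfolding case_prod_beta cbox_interval using nz
      by (intro continuous_on_divide c1 c2) auto
    from integral_continuous_on_param[OF this]
    show ?thesis unfolding log_integral_def cbox_interval .
  qed
  moreover have "exp (of_real (ln (fact n ^ (d - 1))) + log_integral (diagonal_poly d n Z)) = PER d n Z"
    if Z: "Z \<in> ?D" for Z
  proof -
    have "exp (of_real (ln (fact n ^ (d - 1)))) = (of_real (fact n ^ (d - 1)) :: complex)"
      by (subst exp_of_real) (simp add: fact_gt_zero)
    hence "exp (of_real (ln (fact n ^ (d - 1)))) = poly (diagonal_poly d n Z) 0"
      unfolding p0 by simp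
    thus ?thesis
      using exp_log_integral[of "diagonal_poly d n Z"] nz[OF Z] d
      by (simp add: exp_add poly_diagonal_poly_1)
  qed
  moreover have "log_integral (diagonal_poly d n Z) \<in> \<real>" if Z: "Z \<in> ?D" and real: "\<forall>xs. Z xs \<in> \<real>" for Z
  proof -
    let ?f = "diagonal_poly d n Z"
    let ?\<phi> = "\<lambda>t::real. poly (pderiv ?f) (of_real t) / poly ?f (of_real t)"
    have fact_real: "fact i \<in> (\<real> :: complex set)" for i
      by (metis of_real_fact Reals_of_real)
    have "?\<phi> t \<in> \<real>" for t
    proof -
      have "poly ?f (of_real t) \<in> \<real>"
        unfolding poly_diagonal_poly using real
        by (intro sum_in_Reals Reals_mult prod_in_Reals Reals_power Reals_diff fact_real) auto
      moreover have "poly (pderiv ?f) (of_real t) \<in> \<real>"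
        unfolding diagonal_poly_def higher_pderiv_sum[where n = 1, simplified] pderiv_monom poly_sum poly_monom using real
        by (intro sum_in_Reals Reals_mult prod_in_Reals Reals_power Reals_diff fact_real) auto
      ultimately show ?thesis by (rule Reals_divide[rotated])
    qed
    hence "Im \<circ> ?\<phi> = (\<lambda>_. 0)" by (auto simp: fun_eq_iff complex_is_Real_iff)
    moreover have "?\<phi> integrable_on {0..1}"
      using nz[OF Z] by (intro integrable_continuous_real log_derivative_continuous)
    ultimately have "Im (log_integral ?f) = 0"
      using integral_linear[OF _ bounded_linear_Im, of ?\<phi> "{0..1}"] by (simp add: log_integral_def)
    thus ?thesis by (simp add: complex_is_Real_iff)
  qed
  ultimately show ?thesis unfolding lnPER_branch_def
    by (auto intro!: continuous_intros Reals_add)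
qed

lemma lnPER_eq_log_integral:
  assumes "d \<ge> 2" "n \<ge> 1" "A \<in> near_ones d n (eta_max d)"
  shows "lnPER d n A = of_real (ln (fact n ^ (d - 1))) + log_integral (diagonal_poly d n A)"
proof -
  have "lnPER_branch d n (lnPER d n)"
    unfolding lnPER_def by (rule someI[of "lnPER_branch d n"], rule lnPER_branch_log_integral[OF assms(1,2)])
  from lnPER_branch_unique[OF this lnPER_branch_log_integral[OF assms(1,2)] assms(3)]
  show ?thesis .
qed

section \<open>Taylor polynomials of the logarithm\<close>

lemma log_deriv_fps_mult:
  fixes F G :: "complex fps"
  assumes "F $ 0 \<noteq> 0" "G $ 0 \<noteq> 0"
  shows "fps_deriv (F * G) * inverse (F * G) = fps_deriv F * inverse F + fps_deriv G * inverse G"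
proof -
  have "F * inverse F = 1" "G * inverse G = 1" using assms by (simp_all add: inverse_mult_eq_1')
  moreover have "fps_deriv (F * G) * inverse (F * G) =
    fps_deriv F * inverse F * (G * inverse G) + fps_deriv G * inverse G * (F * inverse F)"
    by (simp add: fps_inverse_mult algebra_simps)
  ultimately show ?thesis by simp
qed

text \<open>
  The logarithmic derivative of $1 + yz$ is the geometric series $y \sum_k (-yz)^k$.
\<close>

lemma log_deriv_fps_linear:
  "(fps_deriv (fps_of_poly [:1, y:]) * inverse (fps_of_poly [:1, y :: complex:])) $ k = y * (- y) ^ k"
proof -
  let ?G = "Abs_fps (\<lambda>k. (- y) ^ k)"
  have "(1 + fps_const y * fps_X) * ?G = 1"
  proof (rule fps_ext)
    fix k show "((1 + fps_const y * fps_X) * ?G) $ k = 1 $ k"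
      by (cases k) (simp_all add: distrib_right mult.assoc)
  qed
  hence "inverse (1 + fps_const y * fps_X) = ?G"
    by (simp add: fps_inverse_unique)
  thus ?thesis by (simp add: fps_of_poly_pCons mult.commute[of fps_X])
qed

text \<open>
  The logarithmic derivative is additive over linear factors, so it suffices to treat $1 + yz$ with
  $|y| < 1/R$. There the remainder is $y(-yt)^m/(1 + yt)$, of modulus at most $R^{-m}/(R-1)$.
\<close>

lemma log_deriv_taylor_bound:
  fixes f :: "complex poly"
  assumes "degree f \<le> n" "R > 1" "\<And>z. cmod z \<le> R \<Longrightarrow> poly f z \<noteq> 0" "cmod t \<le> 1"
  shows "cmod (poly (pderiv f) t / poly f t
      - (\<Sum>k<m. (fps_deriv (fps_of_poly f) * inverse (fps_of_poly f)) $ k * t ^ k))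
    \<le> real n / ((R - 1) * R ^ m)"
  using assms(1,3)
proof (induction n arbitrary: f)
  case 0
  then obtain c where "f = [:c:]" by (auto elim: degree_eq_zeroE)
  thus ?case by (simp add: fps_of_poly_const pderiv_pCons)
next
  case (Suc n)
  show ?case
  proof (cases "degree f = 0")
    case True
    then obtain c where "f = [:c:]" by (auto elim: degree_eq_zeroE)
    thus ?thesis using assms(2) by (simp add: fps_of_poly_const pderiv_pCons)
  next
    case False
    then obtain y g where g: "f = [:1, y:] * g" "degree f = Suc (degree g)" "cmod y * R < 1"
      "\<And>z. cmod z \<le> R \<Longrightarrow> poly g z \<noteq> 0"
      using nonvanishing_poly_factor[of f R] Suc.prems assms(2) by auto
    have gt: "poly g t \<noteq> 0" and ft: "poly f t \<noteq> 0" using g(4) Suc.prems(2) assms(2,4) by auto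
    have yR: "cmod y \<le> 1 / R" using g(3) assms(2) by (simp add: field_simps)
    hence yt: "cmod (y * t) \<le> 1 / R" using assms(4) mult_mono[of "cmod y" "1/R" "cmod t" 1] assms(2)
      by (simp add: norm_mult)
    have low: "1 - 1 / R \<le> cmod (1 + y * t)"
      using norm_triangle_ineq2[of 1 "- (y * t)"] yt by simp
    have Rp: "1 - 1 / R > 0" using assms(2) by simp
    hence yt0: "1 + y * t \<noteq> 0" using low by auto
    have ld: "poly (pderiv f) t / poly f t = y / (1 + y * t) + poly (pderiv g) t / poly g t"
      unfolding g(1) pderiv_mult using gt yt0 by (simp add: pderiv_pCons field_simps)
    have "poly g 0 \<noteq> 0" using g(4)[of 0] assms(2) by (metis norm_zero less_eq_real_def less_trans zero_less_one)
    hence g0: "coeff g 0 \<noteq> 0" by (simp add: poly_0_coeff_0)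
    have lf: "(fps_deriv (fps_of_poly f) * inverse (fps_of_poly f)) $ k =
      y * (- y) ^ k + (fps_deriv (fps_of_poly g) * inverse (fps_of_poly g)) $ k" for k
      unfolding g(1) fps_of_poly_mult
      by (subst log_deriv_fps_mult) (simp_all add: g0 log_deriv_fps_linear fps_of_poly_nth del: fps_mult_nth)
    have geo: "y / (1 + y * t) - (\<Sum>k<m. y * (- y) ^ k * t ^ k) = y * (- (y * t)) ^ m / (1 + y * t)"
    proof -
      have "(\<Sum>k<m. y * (- y) ^ k * t ^ k) = y * (\<Sum>k<m. (- (y * t)) ^ k)"
        by (simp add: sum_distrib_left mult.assoc power_mult_distrib[symmetric])
      also have "(\<Sum>k<m. (- (y * t)) ^ k) = (1 - (- (y * t)) ^ m) / (1 + y * t)"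
      proof -
        have "- (y * t) \<noteq> 1" using yt0 by (metis add.right_inverse add.inverse_inverse add.commute)
        thus ?thesis using sum_gp_strict[of "- (y * t)" m] by simp
      qed
      finally show ?thesis using yt0 by (simp add: field_simps)
    qed
    have "cmod (y * (- (y * t)) ^ m / (1 + y * t)) = cmod y * cmod (y * t) ^ m / cmod (1 + y * t)"
      by (simp add: norm_divide norm_mult norm_power)
    also have "\<dots> \<le> (1 / R) * (1 / R) ^ m / (1 - 1 / R)"
      using yR yt low Rp assms(2)
      by (intro frac_le mult_mono power_mono mult_nonneg_nonneg) auto
    also have "\<dots> = 1 / ((R - 1) * R ^ m)" using assms(2) by (simp add: field_simps)
    finally have one: "cmod (y / (1 + y * t) - (\<Sum>k<m. y * (- y) ^ k * t ^ k)) \<le> 1 / ((R - 1) * R ^ m)"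
      unfolding geo .
    have IH: "cmod (poly (pderiv g) t / poly g t
      - (\<Sum>k<m. (fps_deriv (fps_of_poly g) * inverse (fps_of_poly g)) $ k * t ^ k)) \<le> real n / ((R - 1) * R ^ m)"
      using Suc.IH[of g] g(2,4) Suc.prems by simp
    have "poly (pderiv f) t / poly f t
      - (\<Sum>k<m. (fps_deriv (fps_of_poly f) * inverse (fps_of_poly f)) $ k * t ^ k) =
      (y / (1 + y * t) - (\<Sum>k<m. y * (- y) ^ k * t ^ k)) + (poly (pderiv g) t / poly g t
      - (\<Sum>k<m. (fps_deriv (fps_of_poly g) * inverse (fps_of_poly g)) $ k * t ^ k))"
      unfolding ld lf by (simp add: distrib_right sum.distrib del: fps_mult_nth)
    hence "cmod (poly (pderiv f) t / poly f t
      - (\<Sum>k<m. (fps_deriv (fps_of_poly f) * inverse (fps_of_poly f)) $ k * t ^ k)) \<le>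
      1 / ((R - 1) * R ^ m) + real n / ((R - 1) * R ^ m)"
      using norm_triangle_le[OF add_mono[OF one IH]] by simp
    thus ?thesis by (simp add: add_divide_distrib del: fps_mult_nth)
  qed
qed

lemma log_integral_taylor_bound:
  fixes f :: "complex poly"
  assumes "degree f \<le> n" "R > 1" "\<And>z. cmod z \<le> R \<Longrightarrow> poly f z \<noteq> 0"
  shows "cmod (log_integral f
      - (\<Sum>k<m. (fps_deriv (fps_of_poly f) * inverse (fps_of_poly f)) $ k / of_nat (k + 1)))
    \<le> real n / ((R - 1) * R ^ m)"
proof -
  define h where "h k = (fps_deriv (fps_of_poly f) * inverse (fps_of_poly f)) $ k" for k
  have nz: "poly f (of_real t) \<noteq> 0" if "t \<in> {0..1}" for t :: real
    using assms that by auto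
  have I1: "((\<lambda>t::real. poly (pderiv f) (of_real t) / poly f (of_real t)) has_integral log_integral f) {0..1}"
    unfolding log_integral_def
    by (intro integrable_integral integrable_continuous_real log_derivative_continuous nz)
  have "((\<lambda>t::real. (\<Sum>k<m. h k * of_real t ^ k)) has_integral
     ((\<Sum>k<m. h k / of_nat (k + 1) * of_real 1 ^ (k + 1)) - (\<Sum>k<m. h k / of_nat (k + 1) * of_real 0 ^ (k + 1)))) {0..1}"
  proof (rule fundamental_theorem_of_calculus)
    fix t :: real assume "t \<in> {0..1}"
    have "((\<lambda>z. \<Sum>k<m. h k / of_nat (k + 1) * z ^ (k + 1)) has_field_derivative
        (\<Sum>k<m. h k * of_real t ^ k)) (at (of_real t))"
    proof (intro DERIV_sum)
      fix k
      have "((\<lambda>z. h k / of_nat (k + 1) * z ^ (k + 1)) has_field_derivative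
          h k / of_nat (k + 1) * (of_nat (k + 1) * of_real t ^ k)) (at (of_real t))"
        using DERIV_power_Suc[OF DERIV_ident, where n = k] by (intro DERIV_cmult) simp
      thus "((\<lambda>z. h k / of_nat (k + 1) * z ^ (k + 1)) has_field_derivative h k * of_real t ^ k) (at (of_real t))"
        by (simp del: of_nat_Suc of_nat_add)
    qed
    thus "((\<lambda>t. \<Sum>k<m. h k / of_nat (k + 1) * of_real t ^ (k + 1)) has_vector_derivative
        (\<Sum>k<m. h k * of_real t ^ k)) (at t within {0..1})"
      by (rule has_vector_derivative_real_field)
  qed simp
  hence I2: "((\<lambda>t::real. (\<Sum>k<m. h k * of_real t ^ k)) has_integral (\<Sum>k<m. h k / of_nat (k + 1))) {0..1}"
    by simp
  have "cmod (log_integral f - (\<Sum>k<m. h k / of_nat (k + 1))) \<le> real n / ((R - 1) * R ^ m) * measure lborel {0..1::real}"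
  proof (rule has_integral_bound_real[OF _ finite.emptyI has_integral_diff[OF I1 I2]])
    show "0 \<le> real n / ((R - 1) * R ^ m)" using assms(2) by simp
    fix t :: real assume "t \<in> {0..1} - {}"
    thus "cmod (poly (pderiv f) (of_real t) / poly f (of_real t) - (\<Sum>k<m. h k * of_real t ^ k))
        \<le> real n / ((R - 1) * R ^ m)"
      unfolding h_def using assms by (intro log_deriv_taylor_bound) auto
  qed
  thus ?thesis by (simp add: h_def)
qed

section \<open>Functions given by polynomials of bounded degree\<close>

text \<open>
  Being a polynomial function is closed under the operations below, which makes it possible to
  exhibit polynomials of controlled degree without writing down their coefficients.
\<close>

definition is_polynomial :: "'v set \<Rightarrow> nat \<Rightarrow> (('v \<Rightarrow> complex) \<Rightarrow> complex) \<Rightarrow> bool" where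
  "is_polynomial W k \<phi> \<longleftrightarrow>
    (\<exists>p :: 'v cpoly. poly_vars p \<subseteq> W \<and> total_degree p \<le> k \<and> (\<forall>x. poly_eval p x = \<phi> x))"

definition monomial_degree :: "('v \<Rightarrow>\<^sub>0 nat) \<Rightarrow> nat" where
  "monomial_degree m = (\<Sum>v\<in>Poly_Mapping.keys m. Poly_Mapping.lookup m v)"

definition monomial_eval :: "('v \<Rightarrow>\<^sub>0 nat) \<Rightarrow> ('v \<Rightarrow> complex) \<Rightarrow> complex" where
  "monomial_eval m x = (\<Prod>v\<in>Poly_Mapping.keys m. x v ^ Poly_Mapping.lookup m v)"

lemma total_degree_le_iff: "total_degree p \<le> k \<longleftrightarrow> (\<forall>m\<in>Poly_Mapping.keys p. monomial_degree m \<le> k)"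
  by (auto simp: total_degree_def monomial_degree_def)

lemma poly_eval_superset:
  assumes "finite S" "Poly_Mapping.keys p \<subseteq> S"
  shows "poly_eval p x = (\<Sum>m\<in>S. Poly_Mapping.lookup p m * monomial_eval m x)"
  unfolding poly_eval_def monomial_eval_def
  using assms by (intro sum.mono_neutral_left) (auto simp: in_keys_iff)

lemma monomial_eval_superset:
  assumes "finite S" "Poly_Mapping.keys m \<subseteq> S"
  shows "monomial_eval m x = (\<Prod>v\<in>S. x v ^ Poly_Mapping.lookup m v)"
  unfolding monomial_eval_def
  using assms by (intro prod.mono_neutral_left) (auto simp: in_keys_iff)

lemma monomial_degree_superset:
  assumes "finite S" "Poly_Mapping.keys m \<subseteq> S"
  shows "monomial_degree m = (\<Sum>v\<in>S. Poly_Mapping.lookup m v)"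
  unfolding monomial_degree_def
  using assms by (intro sum.mono_neutral_left) (auto simp: in_keys_iff)

lemma monomial_eval_add: "monomial_eval (m + m') x = monomial_eval m x * monomial_eval m' x"
proof -
  let ?S = "Poly_Mapping.keys m \<union> Poly_Mapping.keys m'"
  have "monomial_eval (m + m') x = (\<Prod>v\<in>?S. x v ^ Poly_Mapping.lookup (m + m') v)"
    using keys_add[of m m'] by (intro monomial_eval_superset) auto
  moreover have "monomial_eval m x = (\<Prod>v\<in>?S. x v ^ Poly_Mapping.lookup m v)"
    by (intro monomial_eval_superset) auto
  moreover have "monomial_eval m' x = (\<Prod>v\<in>?S. x v ^ Poly_Mapping.lookup m' v)"
    by (intro monomial_eval_superset) auto
  ultimately show ?thesis by (simp add: lookup_add power_add prod.distrib)
qed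

lemma monomial_degree_add: "monomial_degree (m + m') = monomial_degree m + monomial_degree m'"
proof -
  let ?S = "Poly_Mapping.keys m \<union> Poly_Mapping.keys m'"
  have "monomial_degree (m + m') = (\<Sum>v\<in>?S. Poly_Mapping.lookup (m + m') v)"
    using keys_add[of m m'] by (intro monomial_degree_superset) auto
  moreover have "monomial_degree m = (\<Sum>v\<in>?S. Poly_Mapping.lookup m v)"
    by (intro monomial_degree_superset) auto
  moreover have "monomial_degree m' = (\<Sum>v\<in>?S. Poly_Mapping.lookup m' v)"
    by (intro monomial_degree_superset) auto
  ultimately show ?thesis by (simp add: lookup_add sum.distrib)
qed

lemma is_polynomial_monomial:
  assumes "Poly_Mapping.keys m \<subseteq> W" "monomial_degree m \<le> k"
  shows "is_polynomial W k (\<lambda>x. c * monomial_eval m x)"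
  unfolding is_polynomial_def
proof (intro exI conjI allI)
  let ?p = "Poly_Mapping.single m c"
  show "poly_vars ?p \<subseteq> W" using assms by (auto simp: poly_vars_def split: if_splits)
  show "total_degree ?p \<le> k" using assms by (auto simp: total_degree_le_iff split: if_splits)
  fix x show "poly_eval ?p x = c * monomial_eval m x"
    by (subst poly_eval_superset[of "{m}"]) auto
qed

lemma is_polynomial_const [intro]: "is_polynomial W k (\<lambda>x. c)"
  using is_polynomial_monomial[of 0 W k c] by (simp add: monomial_eval_def monomial_degree_def)

lemma is_polynomial_var: "v \<in> W \<Longrightarrow> 1 \<le> k \<Longrightarrow> is_polynomial W k (\<lambda>x. x v)"
  using is_polynomial_monomial[of "Poly_Mapping.single v 1" W k 1]
  by (simp add: monomial_eval_def monomial_degree_def)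

lemma is_polynomial_mono: "is_polynomial W j \<phi> \<Longrightarrow> j \<le> k \<Longrightarrow> is_polynomial W k \<phi>"
  by (auto simp: is_polynomial_def intro: order.trans)

lemma is_polynomial_add:
  assumes "is_polynomial W k \<phi>" "is_polynomial W k \<psi>"
  shows "is_polynomial W k (\<lambda>x. \<phi> x + \<psi> x)"
proof -
  obtain p where p: "poly_vars p \<subseteq> W" "total_degree p \<le> k" "\<And>x. poly_eval p x = \<phi> x"
    using assms(1) by (auto simp: is_polynomial_def)
  obtain q where q: "poly_vars q \<subseteq> W" "total_degree q \<le> k" "\<And>x. poly_eval q x = \<psi> x"
    using assms(2) by (auto simp: is_polynomial_def)
  let ?S = "Poly_Mapping.keys p \<union> Poly_Mapping.keys q"
  have keys: "Poly_Mapping.keys (p + q) \<subseteq> ?S" by (rule keys_add)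
  have "poly_eval (p + q) x = \<phi> x + \<psi> x" for x
  proof -
    have "poly_eval (p + q) x = (\<Sum>m\<in>?S. Poly_Mapping.lookup (p + q) m * monomial_eval m x)"
      using keys by (intro poly_eval_superset) auto
    also have "\<dots> = poly_eval p x + poly_eval q x"
      by (simp add: poly_eval_superset[of ?S] lookup_add distrib_right sum.distrib)
    finally show ?thesis using p q by simp
  qed
  moreover have "poly_vars (p + q) \<subseteq> W" using p(1) q(1) keys unfolding poly_vars_def by blast
  moreover have "total_degree (p + q) \<le> k" using p(2) q(2) keys unfolding total_degree_le_iff by blast
  ultimately show ?thesis unfolding is_polynomial_def by blast
qed

lemma is_polynomial_sum:
  assumes "\<And>i. i \<in> I \<Longrightarrow> is_polynomial W k (\<phi> i)"
  shows "is_polynomial W k (\<lambda>x. \<Sum>i\<in>I. \<phi> i x)"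
  using assms
  by (induction I rule: infinite_finite_induct) (auto intro: is_polynomial_add)

lemma is_polynomial_mult:
  assumes "is_polynomial W j \<phi>" "is_polynomial W k \<psi>"
  shows "is_polynomial W (j + k) (\<lambda>x. \<phi> x * \<psi> x)"
proof -
  obtain p where p: "poly_vars p \<subseteq> W" "total_degree p \<le> j" "\<And>x. poly_eval p x = \<phi> x"
    using assms(1) by (auto simp: is_polynomial_def)
  obtain q where q: "poly_vars q \<subseteq> W" "total_degree q \<le> k" "\<And>x. poly_eval q x = \<psi> x"
    using assms(2) by (auto simp: is_polynomial_def)
  have "is_polynomial W (j + k) (\<lambda>x. \<Sum>m\<in>Poly_Mapping.keys p. \<Sum>m'\<in>Poly_Mapping.keys q.
      (Poly_Mapping.lookup p m * Poly_Mapping.lookup q m') * monomial_eval (m + m') x)"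
  proof (intro is_polynomial_sum is_polynomial_monomial)
    fix m m' assume m: "m \<in> Poly_Mapping.keys p" "m' \<in> Poly_Mapping.keys q"
    show "Poly_Mapping.keys (m + m') \<subseteq> W"
      using p(1) q(1) m keys_add[of m m'] unfolding poly_vars_def by blast
    show "monomial_degree (m + m') \<le> j + k"
      using p(2) q(2) m by (auto simp: monomial_degree_add total_degree_le_iff intro: add_mono)
  qed
  also have "(\<lambda>x. \<Sum>m\<in>Poly_Mapping.keys p. \<Sum>m'\<in>Poly_Mapping.keys q.
      (Poly_Mapping.lookup p m * Poly_Mapping.lookup q m') * monomial_eval (m + m') x) = (\<lambda>x. \<phi> x * \<psi> x)"
    unfolding p(3)[symmetric] q(3)[symmetric] poly_eval_def monomial_eval_def[symmetric] sum_product
    by (intro ext sum.cong refl) (simp add: monomial_eval_add)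
  finally show ?thesis .
qed

lemma is_polynomial_prod:
  assumes "finite I" "\<And>i. i \<in> I \<Longrightarrow> is_polynomial W 1 (\<phi> i)"
  shows "is_polynomial W (card I) (\<lambda>x. \<Prod>i\<in>I. \<phi> i x)"
  using assms
proof (induction I rule: finite_induct)
  case (insert i I)
  thus ?case using is_polynomial_mult[of W 1 "\<phi> i" "card I" "\<lambda>x. \<Prod>i\<in>I. \<phi> i x"] by simp
qed auto

lemma is_polynomial_fps_mult:
  fixes F G :: "('v \<Rightarrow> complex) \<Rightarrow> complex fps"
  assumes "\<And>i. is_polynomial W (i + j) (\<lambda>x. F x $ i)" "\<And>i. is_polynomial W i (\<lambda>x. G x $ i)"
  shows "is_polynomial W (k + j) (\<lambda>x. (F x * G x) $ k)"
  unfolding fps_mult_nth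
proof (rule is_polynomial_sum)
  fix i assume i: "i \<in> {0..k}"
  have "is_polynomial W (i + j + (k - i)) (\<lambda>x. F x $ i * G x $ (k - i))"
    by (intro is_polynomial_mult assms)
  thus "is_polynomial W (k + j) (\<lambda>x. F x $ i * G x $ (k - i))" using i by (simp add: add.commute)
qed

text \<open>
  The recursion $c\, g_k = - \sum_{i=1}^{k} f_i g_{k-i}$ for the coefficients $g_k$ of $1/F$ divides
  only by the constant $c$, so the degrees stay homogeneous.
\<close>

lemma is_polynomial_fps_inverse:
  fixes F :: "('v \<Rightarrow> complex) \<Rightarrow> complex fps"
  assumes F: "\<And>i. is_polynomial W i (\<lambda>x. F x $ i)" and c: "\<And>x. F x $ 0 = c" "c \<noteq> 0"
  shows "is_polynomial W k (\<lambda>x. inverse (F x) $ k)"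
proof (induction k rule: less_induct)
  case (less k)
  show ?case
  proof (cases "k = 0")
    case True
    thus ?thesis using c by auto
  next
    case False
    have "is_polynomial W k (\<lambda>x. \<Sum>i=1..k. F x $ i * inverse (F x) $ (k - i))"
    proof (rule is_polynomial_sum)
      fix i assume i: "i \<in> {1..k}"
      have "is_polynomial W (i + (k - i)) (\<lambda>x. F x $ i * inverse (F x) $ (k - i))"
        using i False by (intro is_polynomial_mult F less) auto
      thus "is_polynomial W k (\<lambda>x. F x $ i * inverse (F x) $ (k - i))" using i by simp
    qed
    from is_polynomial_mult[OF is_polynomial_const[of W 0 "- inverse c"] this]
    have "is_polynomial W k (\<lambda>x. - inverse c * (\<Sum>i=1..k. F x $ i * inverse (F x) $ (k - i)))" by simp
    also have "(\<lambda>x. - inverse c * (\<Sum>i=1..k. F x $ i * inverse (F x) $ (k - i))) = (\<lambda>x. inverse (F x) $ k)"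
    proof
      fix x
      have "(F x * inverse (F x)) $ k = 0" using c False by (simp add: inverse_mult_eq_1')
      moreover have "(F x * inverse (F x)) $ k = c * inverse (F x) $ k + (\<Sum>i=1..k. F x $ i * inverse (F x) $ (k - i))"
        unfolding fps_mult_nth by (simp add: sum.atLeast_Suc_atMost c)
      ultimately have "c * inverse (F x) $ k = - (\<Sum>i=1..k. F x $ i * inverse (F x) $ (k - i))"
        by (simp add: eq_neg_iff_add_eq_0)
      thus "- inverse c * (\<Sum>i=1..k. F x $ i * inverse (F x) $ (k - i)) = inverse (F x) $ k"
        using c by (simp add: field_simps)
    qed
    finally show ?thesis .
  qed
qed

lemma is_polynomial_fps_log_deriv:
  fixes F :: "('v \<Rightarrow> complex) \<Rightarrow> complex fps"
  assumes F: "\<And>i. is_polynomial W i (\<lambda>x. F x $ i)" and c: "\<And>x. F x $ 0 = c" "c \<noteq> 0"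
  shows "is_polynomial W (k + 1) (\<lambda>x. (fps_deriv (F x) * inverse (F x)) $ k)"
proof (rule is_polynomial_fps_mult)
  fix i
  show "is_polynomial W i (\<lambda>x. inverse (F x) $ i)" using assms by (rule is_polynomial_fps_inverse)
  have "is_polynomial W (0 + (i + 1)) (\<lambda>x. of_nat (i + 1) * F x $ (i + 1))"
    by (intro is_polynomial_mult is_polynomial_const F)
  thus "is_polynomial W (i + 1) (\<lambda>x. fps_deriv (F x) $ i)" by simp
qed

section \<open>Approximation of the logarithm of the permanent\<close>

lemma near_ones_mono: "r \<le> s \<Longrightarrow> near_ones d n r \<subseteq> near_ones d n s"
proof
  fix A assume rs: "r \<le> s" and A: "A \<in> near_ones d n r"
  have "r * real n ^ (d - 1) \<le> s * real n ^ (d - 1)" using rs by (rule mult_right_mono) simp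
  thus "A \<in> near_ones d n s" using A unfolding near_ones_def by (blast intro: order.trans)
qed

lemma is_polynomial_coeff_diagonal_poly:
  "is_polynomial (tensor_indices d n) k (\<lambda>A. coeff (diagonal_poly d n A) k)"
  unfolding coeff_diagonal_poly
proof (rule is_polynomial_sum)
  fix M assume M: "M \<in> {M \<in> partial_diagonals d n. card M = k}"
  have "is_polynomial (tensor_indices d n) (card M) (\<lambda>A. \<Prod>e\<in>M. A e + (- 1))"
    using M finite_partial_diagonal
    by (intro is_polynomial_prod is_polynomial_add is_polynomial_const is_polynomial_var)
      (auto simp: partial_diagonals_def)
  from is_polynomial_mult[OF is_polynomial_const[of _ 0 "fact (n - k) ^ (d - 1)"] this]
  show "is_polynomial (tensor_indices d n) k (\<lambda>A. fact (n - k) ^ (d - 1) * (\<Prod>e\<in>M. A e - 1))"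
    using M by simp
qed

text \<open>
  The polynomial is the Taylor polynomial of $t \mapsto \ln \mathrm{PER}(J + t(A - J))$ at 0,
  evaluated at $t = 1$.
\<close>

lemma lnPER_polynomial_approximation:
  assumes d: "d \<ge> 2" and n: "n \<ge> 1" and R: "R > 1" and S: "S \<subseteq> near_ones d n (eta_max d)"
    and nz: "\<And>A z. A \<in> S \<Longrightarrow> cmod z \<le> R \<Longrightarrow> poly (diagonal_poly d n A) z \<noteq> 0"
  shows "\<exists>p :: nat list cpoly. poly_vars p \<subseteq> tensor_indices d n \<and> total_degree p \<le> m \<and>
    (\<forall>A\<in>S. cmod (lnPER d n A - poly_eval p A) \<le> real n / ((R - 1) * R ^ m))"
proof -
  define h where "h k A = (fps_deriv (fps_of_poly (diagonal_poly d n A)) *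
    inverse (fps_of_poly (diagonal_poly d n A))) $ k" for k A
  define \<phi> where "\<phi> A = of_real (ln (fact n ^ (d - 1))) + (\<Sum>k<m. h k A / of_nat (k + 1))" for A
  have "is_polynomial (tensor_indices d n) m \<phi>"
    unfolding \<phi>_def
  proof (intro is_polynomial_add is_polynomial_const is_polynomial_sum)
    fix k assume k: "k \<in> {..<m}"
    have "is_polynomial (tensor_indices d n) (k + 1) (h k)"
      unfolding h_def
      by (rule is_polynomial_fps_log_deriv[where c = "fact n ^ (d - 1)"])
        (simp_all add: is_polynomial_coeff_diagonal_poly coeff_diagonal_poly_0)
    hence "is_polynomial (tensor_indices d n) m (h k)"
      using k by (elim is_polynomial_mono) simp
    from is_polynomial_mult[OF is_polynomial_const[of _ 0 "1 / of_nat (k + 1)"] this]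
    show "is_polynomial (tensor_indices d n) m (\<lambda>A. h k A / of_nat (k + 1))" by simp
  qed
  then obtain p where p: "poly_vars p \<subseteq> tensor_indices d n" "total_degree p \<le> m" "\<And>A. poly_eval p A = \<phi> A"
    unfolding is_polynomial_def by blast
  have "cmod (lnPER d n A - poly_eval p A) \<le> real n / ((R - 1) * R ^ m)" if A: "A \<in> S" for A
  proof -
    have "lnPER d n A - poly_eval p A
        = log_integral (diagonal_poly d n A) - (\<Sum>k<m. h k A / of_nat (k + 1))"
      using lnPER_eq_log_integral[OF d n] A S by (auto simp: p(3) \<phi>_def)
    thus ?thesis unfolding h_def
      using log_integral_taylor_bound[OF _ R nz[OF A], of n m] degree_diagonal_poly d by simp
  qed
  thus ?thesis using p by blast
qed

lemma eta_max_pos: "d \<ge> 2 \<Longrightarrow> eta_max d > 0"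
  using alpha_pos by (simp add: eta_max_def)

text \<open>
  The bound follows from $\alpha < 1/2$ and $(d-1)^{d-1}/d^d \le 1/d$.
\<close>

lemma eta_max_le: 
  assumes "d \<ge> 2" shows "eta_max d \<le> 1 / 4"
proof -
  obtain k where k: "d = Suc (Suc k)" using assms by (metis add_2_eq_Suc le_Suc_ex)
  have "eta_max d = alpha ^ Suc k * ((real (Suc k) / real d) ^ Suc k) * (1 / real d)"
    by (simp add: eta_max_def k power_divide)
  also have "\<dots> \<le> (1 / 2) * 1 * (1 / 2)"
  proof (intro mult_mono)
    have "alpha ^ k \<le> 1" using alpha_pos alpha_less_half by (simp add: power_le_one)
    thus "alpha ^ Suc k \<le> 1 / 2"
      using mult_mono[of alpha "1 / 2" "alpha ^ k" 1] alpha_pos alpha_less_half by simp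
    show "(real (Suc k) / real d) ^ Suc k \<le> 1" by (rule power_le_one) (auto simp: k)
  qed (use alpha_pos in \<open>auto simp: k\<close>)
  finally show ?thesis by simp
qed

text \<open>
  For $n = 1$ the permanent is the single entry and the zero-free disc is much larger. This covers the
  case $n = 1$ and $\epsilon$ close to 1, where the degree bound may permit only constants.
\<close>

lemma diagonal_poly_one_nonzero:
  assumes d: "d \<ge> 2" and A: "A \<in> near_ones d 1 (eta_max d)" and z: "cmod z \<le> 3"
  shows "poly (diagonal_poly d 1 A) z \<noteq> 0"
proof -
  let ?e = "replicate d (1 :: nat)"
  have E: "tensor_indices d 1 = {?e}"
    by (auto simp: tensor_indices_def intro: replicate_eqI)
  have "partial_diagonals d 1 = {{}, {?e}}"
    unfolding partial_diagonals_def E by auto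
  hence poly: "poly (diagonal_poly d 1 A) z = 1 + (A ?e - 1) * z"
    by (simp add: poly_diagonal_poly)
  have "slice_indices d 1 0 1 = {?e}"
    unfolding slice_indices_def E using d by auto
  moreover have "(\<Sum>xs\<in>slice_indices d 1 0 1. cmod (1 - A xs)) \<le> eta_max d * real 1 ^ (d - 1)"
    using A d unfolding near_ones_def by auto
  ultimately have "cmod (A ?e - 1) \<le> 1 / 4" using eta_max_le[OF d]
    by (simp add: norm_minus_commute)
  hence "cmod ((A ?e - 1) * z) \<le> 1 / 4 * 3" unfolding norm_mult using z by (intro mult_mono) auto
  hence "(A ?e - 1) * z \<noteq> - 1" by auto
  thus ?thesis unfolding poly by (metis add.commute eq_neg_iff_add_eq_0)
qed

theorem theorem3p7:
  fixes d :: nat and \<eta> :: real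
  assumes "d \<ge> 2" and "0 \<le> \<eta>" and "\<eta> < eta_max d"
  shows "\<exists>\<gamma>::real. \<gamma> > 0 \<and>
    (\<forall>(n::nat) (\<epsilon>::real). n \<ge> 1 \<and> 0 < \<epsilon> \<and> \<epsilon> < 1 \<longrightarrow>
      (\<exists>p :: nat list cpoly.
         poly_vars p \<subseteq> tensor_indices d n \<and>
         real (total_degree p) \<le> \<gamma> * (ln (real n) - ln \<epsilon>) \<and>
         (\<forall>A \<in> near_ones d n \<eta>. cmod (lnPER d n A - poly_eval p A) \<le> \<epsilon>)))"
proof -
  \<comment> \<open>The quotient \<open>R\<close> needs a positive denominator; a larger $\eta$ admits more tensors, so $\eta = 0$ may be enlarged.\<close>
  define \<eta>' where "\<eta>' = (if \<eta> = 0 then eta_max d / 2 else \<eta>)"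
  have \<eta>': "0 < \<eta>'" "\<eta> \<le> \<eta>'" "\<eta>' < eta_max d"
    using assms eta_max_pos[OF assms(1)] by (auto simp: \<eta>'_def)
  define R where "R = eta_max d / \<eta>'"
  have R: "R > 1" using \<eta>' by (simp add: R_def)
  hence lnR: "ln R > 0" by simp
  \<comment> \<open>\<open>C\<close> absorbs the factor $1/(R-1)$ of the error bound.\<close>
  define C where "C = max 0 (- ln (R - 1))"
  define \<gamma> where "\<gamma> = (1 + C / ln 2) / ln R + 1 / ln 2"
  have C: "C \<ge> 0" by (simp add: C_def)
  have \<gamma>: "\<gamma> > 0" unfolding \<gamma>_def using C lnR by (intro add_nonneg_pos divide_nonneg_pos) auto
  have sub: "near_ones d n \<eta> \<subseteq> near_ones d n (eta_max d)" for n
    using assms by (intro near_ones_mono) simp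
  have "\<exists>p :: nat list cpoly. poly_vars p \<subseteq> tensor_indices d n \<and>
         real (total_degree p) \<le> \<gamma> * (ln (real n) - ln \<epsilon>) \<and>
         (\<forall>A \<in> near_ones d n \<eta>. cmod (lnPER d n A - poly_eval p A) \<le> \<epsilon>)"
    if n: "n \<ge> 1" and \<epsilon>: "0 < \<epsilon>" "\<epsilon> < 1" for n :: nat and \<epsilon> :: real
  proof -
    define L where "L = ln (real n) - ln \<epsilon>"
    have L0: "L \<ge> 0" using n \<epsilon> by (simp add: L_def ln_le_zero_iff order.trans[of _ 0])
    show ?thesis
    proof (cases "L \<ge> ln 2")
      case True
      \<comment> \<open>For $L \ge \ln 2$ the additive constants in $m \le (L + C)/\ln R + 1$ are absorbed into \<open>\<gamma> * L\<close>.\<close>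
      define m where "m = nat \<lceil>(L + C) / ln R\<rceil>"
      have m: "(L + C) / ln R \<le> real m" "real m \<le> (L + C) / ln R + 1"
        using L0 C lnR unfolding m_def by (auto simp: real_nat_ceiling_ge)
      obtain p :: "nat list cpoly" where p: "poly_vars p \<subseteq> tensor_indices d n" "total_degree p \<le> m"
        "\<And>A. A \<in> near_ones d n \<eta> \<Longrightarrow> cmod (lnPER d n A - poly_eval p A) \<le> real n / ((R - 1) * R ^ m)"
      proof -
        have "poly (diagonal_poly d n A) z \<noteq> 0" if "A \<in> near_ones d n \<eta>" "cmod z \<le> R" for A z
        proof (rule diagonal_poly_nonzero[OF assms(1) n])
          show "A \<in> near_ones d n \<eta>'" using that near_ones_mono[OF \<eta>'(2)] by blast
          show "cmod z * \<eta>' \<le> eta_max d" using that \<eta>' by (simp add: R_def le_divide_eq)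
        qed
        from lnPER_polynomial_approximation[OF assms(1) n R sub this, of m] show ?thesis
          using that by blast
      qed
      have "real m \<le> \<gamma> * L"
      proof -
        have "1 \<le> L / ln 2" using True by (simp add: le_divide_eq)
        moreover from this have "C * 1 \<le> C * (L / ln 2)" using C by (intro mult_left_mono)
        ultimately have "(L + C) / ln R + 1 \<le> (L + C * (L / ln 2)) / ln R + L / ln 2"
          using lnR by (intro add_mono divide_right_mono) auto
        also have "\<dots> = \<gamma> * L" by (simp add: \<gamma>_def algebra_simps add_divide_distrib)
        finally show ?thesis using m by linarith
      qed
      moreover have "real n / ((R - 1) * R ^ m) \<le> \<epsilon>"
      proof -
        have "L + C \<le> real m * ln R" using m lnR by (simp add: divide_le_eq)
        hence "ln (real n) - ln \<epsilon> \<le> ln (R - 1) + real m * ln R"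
          unfolding L_def C_def by linarith
        also have "\<dots> = ln ((R - 1) * R ^ m)" using R by (simp add: ln_mult ln_realpow)
        finally have "ln (real n / \<epsilon>) \<le> ln ((R - 1) * R ^ m)"
          using n \<epsilon> by (simp add: ln_div)
        hence "real n / \<epsilon> \<le> (R - 1) * R ^ m"
          using n \<epsilon> R by (subst (asm) ln_le_cancel_iff) auto
        thus ?thesis using \<epsilon> R by (simp add: field_simps)
      qed
      ultimately show ?thesis using p by (fold L_def) (meson of_nat_mono order.trans)
    next
      case False
      \<comment> \<open>Here $n = 1$ and $\epsilon > 1/2$, and a constant polynomial has error at most $1/2$.\<close>
      have n1: "n = 1"
      proof (rule ccontr)
        assume "n \<noteq> 1"
        hence "ln 2 \<le> ln (real n)" using n by simp
        thus False using False ln_less_zero[OF \<epsilon>] unfolding L_def by linarith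
      qed
      hence "ln (1 / 2) < ln \<epsilon>" using False by (simp add: L_def ln_div)
      hence half: "1 / 2 < \<epsilon>" using \<epsilon> by (subst (asm) ln_less_cancel_iff) auto
      have "poly (diagonal_poly d n A) z \<noteq> 0" if "A \<in> near_ones d n \<eta>" "cmod z \<le> 3" for A z
        using diagonal_poly_one_nonzero[OF assms(1)] that sub n1 by blast
      moreover have "(1 :: real) < 3" by simp
      ultimately obtain p :: "nat list cpoly" where p: "poly_vars p \<subseteq> tensor_indices d n" "total_degree p \<le> 0"
        "\<And>A. A \<in> near_ones d n \<eta> \<Longrightarrow> cmod (lnPER d n A - poly_eval p A) \<le> real n / ((3 - 1) * 3 ^ 0)"
        using lnPER_polynomial_approximation[OF assms(1) n _ sub, of 3 0] by blast
      have "cmod (lnPER d n A - poly_eval p A) \<le> \<epsilon>" if "A \<in> near_ones d n \<eta>" for A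
        using p(3)[OF that] n1 half by simp
      thus ?thesis using p L0 \<gamma> by (fold L_def) auto
    qed
  qed
  thus ?thesis using \<gamma> by blast
qed

end
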